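(* For every infinite cardinal $\lambda$ there is a torsion-free abelian group $G$ of cardinality $\lambda$ which is absolutely Hopfian.
   Context: A group $G$ is Hopfian if every surjective endomorphism of $G$ is injective. A group $G$ (in the set-theoretic universe $\mathrm{V}$) is absolutely Hopfian if $G$ is Hopfian and $G$ remains Hopfian in every forcing extension of the universe $\mathrm{V}$; that is, for every forcing notion $\mathbb{Q} \in \mathrm{V}$, it is forced by $\mathbb{Q}$ that every surjective endomorphism of $G$ is injective. *)

theory Defs
  imports "HOL-Algebra.Group" "HOL-Library.Equipollence"
begin

section \<open>The set-theoretic universe\<close>

text \<open>
  The universe V of sets is a type of class \<open>zfc_universe\<close>: a model of ZFC whose separation and
  replacement axioms are stated for arbitrary predicates and functions of the logic.
  The axiom of choice is not listed, since with these two axioms it follows from Hilbert choice.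
\<close>

class zfc_universe =
  fixes elts :: "'a \<Rightarrow> 'a set"
  assumes extensionality: "elts x = elts y \<Longrightarrow> x = y"
    and foundation: "wf {(y, x). y \<in> elts x}"
    and pairing: "\<exists>z. elts z = {x, y}"
    and union: "\<exists>y. elts y = \<Union> (elts ` elts x)"
    and power_set: "\<exists>y. elts y = {z. elts z \<subseteq> elts x}"
    and separation: "\<exists>y. elts y = {z \<in> elts x. P z}"
    and replacement: "\<exists>y. elts y = F ` elts x"
    and infinity: "\<exists>x. (\<exists>y \<in> elts x. elts y = {}) \<and>
                       (\<forall>y \<in> elts x. \<exists>z \<in> elts x. elts z = insert y (elts y))"

definition is_small :: "'v::zfc_universe set \<Rightarrow> bool" where
  "is_small X \<longleftrightarrow> (\<exists>x. elts x = X)"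

text \<open>The element of V with a given extension; only meaningful for small \<open>X\<close>.\<close>

definition vset :: "'v::zfc_universe set \<Rightarrow> 'v" where
  "vset X = (THE x. elts x = X)"

definition vpair :: "'v::zfc_universe \<Rightarrow> 'v \<Rightarrow> 'v" where
  "vpair x y = vset {vset {x}, vset {x, y}}"

definition transitive_set :: "'v::zfc_universe \<Rightarrow> bool" where
  "transitive_set x \<longleftrightarrow> (\<forall>y \<in> elts x. elts y \<subseteq> elts x)"

definition ordinal :: "'v::zfc_universe \<Rightarrow> bool" where
  "ordinal x \<longleftrightarrow> transitive_set x \<and> (\<forall>y \<in> elts x. transitive_set y)"

definition infinite_cardinal :: "'v::zfc_universe \<Rightarrow> bool" where
  "infinite_cardinal \<kappa> \<longleftrightarrow>
     ordinal \<kappa> \<and> (\<forall>\<alpha> \<in> elts \<kappa>. \<not> elts \<alpha> \<approx> elts \<kappa>) \<and> infinite (elts \<kappa>)"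

lemma elts_vset: "is_small X \<Longrightarrow> elts (vset X) = X"
  unfolding is_small_def vset_def by (rule theI') (auto intro: extensionality)

lemma vset_elts [simp]: "vset (elts x) = x"
  unfolding vset_def by (auto intro: extensionality)

lemma is_small_elts [simp]: "is_small (elts x)"
  by (auto simp: is_small_def)

lemma is_small_image:
  fixes F :: "'v::zfc_universe \<Rightarrow> 'v"
  shows "is_small X \<Longrightarrow> is_small (F ` X)"
  unfolding is_small_def using replacement by auto

lemma is_small_doubleton [simp]: "is_small {x, y}"
  unfolding is_small_def by (rule pairing)

lemma is_small_singleton [simp]: "is_small {x}"
  using is_small_doubleton[of x x] by simp

lemma is_small_Union:
  fixes F :: "'v::zfc_universe \<Rightarrow> 'v set"
  shows "is_small X \<Longrightarrow> (\<And>x. x \<in> X \<Longrightarrow> is_small (F x)) \<Longrightarrow> is_small (\<Union>x\<in>X. F x)"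
proof -
  assume X: "is_small X" and F: "\<And>x. x \<in> X \<Longrightarrow> is_small (F x)"
  from X have "is_small ((\<lambda>x. vset (F x)) ` X)" by (rule is_small_image)
  then obtain z where z: "elts z = (\<lambda>x. vset (F x)) ` X" by (auto simp: is_small_def)
  obtain y where "elts y = \<Union> (elts ` elts z)" using union by blast
  also have "\<dots> = (\<Union>x\<in>X. F x)" using F by (auto simp: z elts_vset)
  finally show ?thesis by (auto simp: is_small_def)
qed

lemma elts_vset_singleton [simp]: "elts (vset {x}) = {x}"
  by (rule elts_vset) simp

lemma elts_vset_doubleton [simp]: "elts (vset {x, y}) = {x, y}"
  by (rule elts_vset) simp

lemma elts_vpair [simp]: "elts (vpair x y) = {vset {x}, vset {x, y}}"
  by (simp add: vpair_def)

lemma vset_eq_iff: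
  assumes "is_small X" "is_small Y"
  shows "vset X = vset Y \<longleftrightarrow> X = Y"
proof
  assume "vset X = vset Y"
  then have "elts (vset X) = elts (vset Y)" by (rule arg_cong)
  then show "X = Y" by (simp only: elts_vset[OF assms(1)] elts_vset[OF assms(2)])
qed (rule arg_cong)

lemma vpair_eq [simp]: "vpair x y = vpair x' y' \<longleftrightarrow> x = x' \<and> y = y'"
proof
  assume "vpair x y = vpair x' y'"
  then have *: "{vset {x}, vset {x, y}} = {vset {x'}, vset {x', y'}}"
    unfolding vpair_def by (simp only: vset_eq_iff is_small_doubleton)
  have sing: "vset {a} = vset {b, c} \<longleftrightarrow> {a} = {b, c}"
       "vset {b, c} = vset {a} \<longleftrightarrow> {b, c} = {a}"
       "vset {a, d} = vset {b, c} \<longleftrightarrow> {a, d} = {b, c}"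
       "vset {a} = vset {b} \<longleftrightarrow> {a} = {b}" for a b c d :: 'a
    by (simp_all only: vset_eq_iff is_small_doubleton is_small_singleton)
  from * show "x = x' \<and> y = y'"
    unfolding doubleton_eq_iff sing by auto
qed simp

section \<open>Groups\<close>

definition torsion_free :: "('a, 'b) monoid_scheme \<Rightarrow> bool" where
  "torsion_free G \<longleftrightarrow>
     (\<forall>x \<in> carrier G. \<forall>n::nat. n > 0 \<and> x [^]\<^bsub>G\<^esub> n = \<one>\<^bsub>G\<^esub> \<longrightarrow> x = \<one>\<^bsub>G\<^esub>)"

definition hopfian :: "('a, 'b) monoid_scheme \<Rightarrow> bool" where
  "hopfian G \<longleftrightarrow>
     (\<forall>f \<in> hom G G. f ` carrier G = carrier G \<longrightarrow> inj_on f (carrier G))"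

text \<open>The group operation as a set of triples \<open>((x, y), x \<otimes> y)\<close> in V.\<close>

definition mult_graph :: "'v::zfc_universe monoid \<Rightarrow> 'v" where
  "mult_graph G =
     vset (\<Union>x\<in>carrier G. \<Union>y\<in>carrier G. {vpair (vpair x y) (x \<otimes>\<^bsub>G\<^esub> y)})"

lemma elts_mult_graph:
  assumes "is_small (carrier G)"
  shows "elts (mult_graph G) =
    {vpair (vpair x y) (x \<otimes>\<^bsub>G\<^esub> y) | x y. x \<in> carrier G \<and> y \<in> carrier G}"
proof -
  have "is_small (\<Union>x\<in>carrier G. \<Union>y\<in>carrier G. {vpair (vpair x y) (x \<otimes>\<^bsub>G\<^esub> y)})"
    by (intro is_small_Union assms is_small_singleton)
  then show ?thesis
    unfolding mult_graph_def by (auto simp: elts_vset)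
qed

section \<open>Formulas of the language of set theory\<close>

text \<open>Variables are natural numbers; an assignment is a function on them.\<close>

datatype fm =
    Mem nat nat
  | Eq nat nat
  | Neg fm
  | And fm fm
  | All nat fm

definition Imp :: "fm \<Rightarrow> fm \<Rightarrow> fm" where "Imp \<phi> \<psi> = Neg (And \<phi> (Neg \<psi>))"
definition Or :: "fm \<Rightarrow> fm \<Rightarrow> fm" where "Or \<phi> \<psi> = Neg (And (Neg \<phi>) (Neg \<psi>))"
definition Iff :: "fm \<Rightarrow> fm \<Rightarrow> fm" where "Iff \<phi> \<psi> = And (Imp \<phi> \<psi>) (Imp \<psi> \<phi>)"
definition Ex :: "nat \<Rightarrow> fm \<Rightarrow> fm" where "Ex i \<phi> = Neg (All i (Neg \<phi>))"
definition AllIn :: "nat \<Rightarrow> nat \<Rightarrow> fm \<Rightarrow> fm" where "AllIn i j \<phi> = All i (Imp (Mem i j) \<phi>)"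
definition ExIn :: "nat \<Rightarrow> nat \<Rightarrow> fm \<Rightarrow> fm" where "ExIn i j \<phi> = Ex i (And (Mem i j) \<phi>)"

primrec sats :: "fm \<Rightarrow> (nat \<Rightarrow> 'v::zfc_universe) \<Rightarrow> bool" where
  "sats (Mem i j) e \<longleftrightarrow> e i \<in> elts (e j)"
| "sats (Eq i j) e \<longleftrightarrow> e i = e j"
| "sats (Neg \<phi>) e \<longleftrightarrow> \<not> sats \<phi> e"
| "sats (And \<phi> \<psi>) e \<longleftrightarrow> sats \<phi> e \<and> sats \<psi> e"
| "sats (All i \<phi>) e \<longleftrightarrow> (\<forall>x. sats \<phi> (e(i := x)))"

text \<open>
  In the following formulas the bound variable is a sum exceeding all parameters, hence fresh.
  \<open>is_upair u x y\<close> says \<open>u = {x, y}\<close>, \<open>is_pair u x y\<close> says \<open>u = (x, y)\<close>,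
  \<open>pair_in x y f\<close> says \<open>(x, y) \<in> f\<close>, and \<open>triple_in x y z m\<close> says \<open>((x, y), z) \<in> m\<close>.
\<close>

definition is_upair :: "nat \<Rightarrow> nat \<Rightarrow> nat \<Rightarrow> fm" where
  "is_upair u x y =
     (let w = u + x + y + 1 in All w (Iff (Mem w u) (Or (Eq w x) (Eq w y))))"

definition is_pair :: "nat \<Rightarrow> nat \<Rightarrow> nat \<Rightarrow> fm" where
  "is_pair u x y =
     (let a = u + x + y + 1; b = u + x + y + 2
      in Ex a (Ex b (And (And (is_upair a x x) (is_upair b x y)) (is_upair u a b))))"

definition pair_in :: "nat \<Rightarrow> nat \<Rightarrow> nat \<Rightarrow> fm" where
  "pair_in x y f = (let u = x + y + f + 1 in Ex u (And (is_pair u x y) (Mem u f)))"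

definition triple_in :: "nat \<Rightarrow> nat \<Rightarrow> nat \<Rightarrow> nat \<Rightarrow> fm" where
  "triple_in x y z m =
     (let u = x + y + z + m + 1 in Ex u (And (is_pair u x y) (pair_in u z m)))"

definition is_function :: "nat \<Rightarrow> nat \<Rightarrow> nat \<Rightarrow> fm" where
  "is_function f a b =
     (let u = f + a + b + 1; x = f + a + b + 2; y = f + a + b + 3; z = f + a + b + 4 in
      And (AllIn u f (ExIn x a (ExIn y b (is_pair u x y))))
          (AllIn x a (Ex y (And (pair_in x y f) (All z (Imp (pair_in x z f) (Eq z y)))))))"

text \<open>\<open>preserves_mult f m\<close>: if \<open>xy = z\<close> under the operation \<open>m\<close>, then \<open>f(x)f(y) = f(z)\<close>.\<close>

definition preserves_mult :: "nat \<Rightarrow> nat \<Rightarrow> fm" where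
  "preserves_mult f m =
     (let x = f + m + 1; y = f + m + 2; z = f + m + 3;
          x' = f + m + 4; y' = f + m + 5; z' = f + m + 6 in
      All x (All y (All z (All x' (All y' (All z'
        (Imp (And (triple_in x y z m)
                  (And (pair_in x x' f) (And (pair_in y y' f) (pair_in z z' f))))
             (triple_in x' y' z' m))))))))"

definition is_onto :: "nat \<Rightarrow> nat \<Rightarrow> nat \<Rightarrow> fm" where
  "is_onto f a b =
     (let x = f + a + b + 1; y = f + a + b + 2 in AllIn y b (ExIn x a (pair_in x y f)))"

definition is_one_one :: "nat \<Rightarrow> fm" where
  "is_one_one f =
     (let x = f + 1; y = f + 2; z = f + 3 in
      All x (All y (All z (Imp (And (pair_in x z f) (pair_in y z f)) (Eq x y)))))"

text \<open>
  Every surjective endomorphism (variable 2) of the group with carrier (variable 0) and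
  operation (variable 1) is injective.
\<close>

definition hopfian_fm :: fm where
  "hopfian_fm =
     All 2 (Imp (And (is_function 2 0 0) (And (preserves_mult 2 1) (is_onto 2 0 0)))
                (is_one_one 2))"

definition group_assignment :: "'v::zfc_universe monoid \<Rightarrow> nat \<Rightarrow> 'v" where
  "group_assignment G = (\<lambda>i. if i = 0 then vset (carrier G) else mult_graph G)"

lemma sats_abbrevs [simp]:
  "sats (Imp \<phi> \<psi>) e \<longleftrightarrow> (sats \<phi> e \<longrightarrow> sats \<psi> e)"
  "sats (Or \<phi> \<psi>) e \<longleftrightarrow> sats \<phi> e \<or> sats \<psi> e"
  "sats (Iff \<phi> \<psi>) e \<longleftrightarrow> (sats \<phi> e \<longleftrightarrow> sats \<psi> e)"
  "sats (Ex i \<phi>) e \<longleftrightarrow> (\<exists>x. sats \<phi> (e(i := x)))"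
  "sats (AllIn i j \<phi>) e \<longleftrightarrow> (\<forall>x. x \<in> elts ((e(i := x)) j) \<longrightarrow> sats \<phi> (e(i := x)))"
  "sats (ExIn i j \<phi>) e \<longleftrightarrow> (\<exists>x. x \<in> elts ((e(i := x)) j) \<and> sats \<phi> (e(i := x)))"
  by (auto simp: Imp_def Or_def Iff_def Ex_def AllIn_def ExIn_def)

lemma eq_vset_doubleton_iff: "u = vset {x, y} \<longleftrightarrow> (\<forall>z. z \<in> elts u \<longleftrightarrow> z = x \<or> z = y)"
proof
  assume "\<forall>z. z \<in> elts u \<longleftrightarrow> z = x \<or> z = y"
  then have "elts u = elts (vset {x, y})" by auto
  then show "u = vset {x, y}" by (rule extensionality)
qed auto

lemma sats_is_upair [simp]: "sats (is_upair u x y) e \<longleftrightarrow> e u = vset {e x, e y}"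
  by (simp add: is_upair_def Let_def eq_vset_doubleton_iff)

lemma sats_is_pair [simp]: "sats (is_pair u x y) e \<longleftrightarrow> e u = vpair (e x) (e y)"
  by (simp add: is_pair_def Let_def vpair_def)

lemma sats_pair_in [simp]: "sats (pair_in x y f) e \<longleftrightarrow> vpair (e x) (e y) \<in> elts (e f)"
  by (simp add: pair_in_def Let_def del: elts_vpair)

lemma sats_triple_in [simp]:
  "sats (triple_in x y z m) e \<longleftrightarrow> vpair (vpair (e x) (e y)) (e z) \<in> elts (e m)"
  by (simp add: triple_in_def Let_def del: elts_vpair)

text \<open>In V itself the formula expresses the Hopf property.\<close>

lemma sats_hopfian_fm:
  fixes G :: "'a::zfc_universe monoid"
  assumes small: "is_small (carrier G)" and G: "Group.monoid G"
  shows "sats hopfian_fm (group_assignment G) \<longleftrightarrow> hopfian G"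
proof -
  interpret Group.monoid G by (rule G)
  let ?C = "carrier G"
  have C: "elts (vset ?C) = ?C" by (rule elts_vset[OF small])
  have M: "vpair (vpair x y) z \<in> elts (mult_graph G) \<longleftrightarrow> x \<in> ?C \<and> y \<in> ?C \<and> z = x \<otimes>\<^bsub>G\<^esub> y" for x y z
    by (auto simp: elts_mult_graph[OF small])
  define fn :: "'a \<Rightarrow> bool" where "fn F \<longleftrightarrow> (\<forall>u \<in> elts F. \<exists>x \<in> ?C. \<exists>y \<in> ?C. u = vpair x y) \<and>
     (\<forall>x \<in> ?C. \<exists>y. vpair x y \<in> elts F \<and> (\<forall>z. vpair x z \<in> elts F \<longrightarrow> z = y))" for F
  define hm :: "'a \<Rightarrow> bool" where "hm F \<longleftrightarrow> (\<forall>x y z x' y' z'. x \<in> ?C \<and> y \<in> ?C \<and> z = x \<otimes>\<^bsub>G\<^esub> y \<and>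
     vpair x x' \<in> elts F \<and> vpair y y' \<in> elts F \<and> vpair z z' \<in> elts F \<longrightarrow>
     x' \<in> ?C \<and> y' \<in> ?C \<and> z' = x' \<otimes>\<^bsub>G\<^esub> y')" for F
  define on :: "'a \<Rightarrow> bool" where "on F \<longleftrightarrow> (\<forall>y \<in> ?C. \<exists>x \<in> ?C. vpair x y \<in> elts F)" for F
  define oo :: "'a \<Rightarrow> bool" where "oo F \<longleftrightarrow> (\<forall>x y z. vpair x z \<in> elts F \<and> vpair y z \<in> elts F \<longrightarrow> x = y)" for F
  have "sats hopfian_fm (group_assignment G) \<longleftrightarrow> (\<forall>F. fn F \<and> hm F \<and> on F \<longrightarrow> oo F)"
    by (simp add: hopfian_fm_def is_function_def preserves_mult_def is_onto_def is_one_one_def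
      Let_def group_assignment_def C M fn_def hm_def on_def oo_def Ball_def Bex_def conj_assoc
      del: elts_vpair)
  also have "\<dots> \<longleftrightarrow> hopfian G"
  proof
    assume *: "\<forall>F. fn F \<and> hm F \<and> on F \<longrightarrow> oo F"
    show "hopfian G"
      unfolding hopfian_def
    proof (intro ballI impI)
      fix f assume f: "f \<in> hom G G" and onto: "f ` ?C = ?C"
      define F where "F = vset ((\<lambda>x. vpair x (f x)) ` ?C)"
      have "elts F = (\<lambda>x. vpair x (f x)) ` ?C"
        unfolding F_def by (rule elts_vset[OF is_small_image[OF small]])
      then have F: "vpair x y \<in> elts F \<longleftrightarrow> x \<in> ?C \<and> y = f x"
        and F': "u \<in> elts F \<longleftrightarrow> (\<exists>x\<in>?C. u = vpair x (f x))" for x y u by auto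
      have "fn F" "hm F" "on F"
        unfolding fn_def hm_def on_def F using f onto
        by (auto simp: F' hom_def Pi_iff)
      with * have "oo F" by blast
      then show "inj_on f ?C" unfolding oo_def F by (auto intro!: inj_onI)
    qed
  next
    assume H: "hopfian G"
    show "\<forall>F. fn F \<and> hm F \<and> on F \<longrightarrow> oo F"
    proof (intro allI impI)
      fix F assume "fn F \<and> hm F \<and> on F"
      then have fn: "fn F" and hm: "hm F" and on: "on F" by auto
      define f where "f x = (THE y. vpair x y \<in> elts F)" for x
      have dom: "x \<in> ?C \<and> y \<in> ?C" if "vpair x y \<in> elts F" for x y
        using fn that unfolding fn_def by (metis vpair_eq)
      have ex: "\<exists>!y. vpair x y \<in> elts F" if "x \<in> ?C" for x
        using fn that unfolding fn_def by metis
      have F: "vpair x y \<in> elts F \<longleftrightarrow> x \<in> ?C \<and> y = f x" for x y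
        using dom ex theI'[OF ex] unfolding f_def by (metis the1_equality)
      have "f \<in> hom G G"
      proof (rule homI)
        show "f x \<in> ?C" if "x \<in> ?C" for x using that F dom by blast
        show "f (x \<otimes>\<^bsub>G\<^esub> y) = f x \<otimes>\<^bsub>G\<^esub> f y" if "x \<in> ?C" "y \<in> ?C" for x y
          using hm that unfolding hm_def F by simp
      qed
      moreover from this have "f ` ?C = ?C"
        using on unfolding on_def F by (auto simp: hom_def)
      ultimately have "inj_on f ?C" using H by (auto simp: hopfian_def)
      then show "oo F" unfolding oo_def F by (auto dest: inj_onD)
    qed
  qed
  finally show ?thesis .
qed
section \<open>Forcing\<close>

text \<open>
  A forcing notion is a nonempty set \<open>Q\<close> with a preorder \<open>R\<close>, given as a set of pairs;
  \<open>(q, p) \<in> R\<close> means that \<open>q\<close> is a stronger condition than \<open>p\<close>.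
\<close>

definition forcing_notion :: "'v::zfc_universe \<Rightarrow> 'v \<Rightarrow> bool" where
  "forcing_notion Q R \<longleftrightarrow>
     elts Q \<noteq> {} \<and>
     (\<forall>p \<in> elts Q. vpair p p \<in> elts R) \<and>
     (\<forall>p \<in> elts Q. \<forall>q \<in> elts Q. \<forall>r \<in> elts Q.
        vpair r q \<in> elts R \<and> vpair q p \<in> elts R \<longrightarrow> vpair r p \<in> elts R)"

definition extensions :: "'v::zfc_universe \<Rightarrow> 'v \<Rightarrow> 'v \<Rightarrow> 'v set" where
  "extensions Q R p = {q \<in> elts Q. vpair q p \<in> elts R}"

inductive is_name :: "'v::zfc_universe \<Rightarrow> 'v \<Rightarrow> bool" for Q where
  "(\<And>u. u \<in> elts x \<Longrightarrow> \<exists>y. is_name Q y \<and> (\<exists>p \<in> elts Q. u = vpair y p)) \<Longrightarrow> is_name Q x"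

text \<open>
  The canonical name of a set of V. As \<open>Q\<close> need not have a weakest condition, all
  conditions are used: the name of \<open>x\<close> consists of the pairs \<open>(check Q y, p)\<close>
  with \<open>y \<in> x\<close> and \<open>p \<in> Q\<close>.
\<close>

function check :: "'v::zfc_universe \<Rightarrow> 'v \<Rightarrow> 'v" where
  "check Q x = vset (\<Union>y\<in>elts x. (\<lambda>p. vpair (check Q y) p) ` elts Q)"
  by pat_completeness auto
termination
  by (relation "inv_image {(y, x). y \<in> elts x} snd") (auto intro: foundation)

declare check.simps [simp del]

lemma elts_check:
  "elts (check Q x) = {vpair (check Q y) p | y p. y \<in> elts x \<and> p \<in> elts Q}"
proof -
  have "is_small (\<Union>y\<in>elts x. (\<lambda>p. vpair (check Q y) p) ` elts Q)"
    by (intro is_small_Union is_small_image is_small_elts)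
  then show ?thesis
    by (subst check.simps) (auto simp: elts_vset)
qed

lemma is_name_check: "is_name Q (check Q x)"
proof (induction x rule: wf_induct_rule[OF foundation])
  case (1 x)
  then show ?case by (intro is_name.intros) (auto simp: elts_check)
qed

text \<open>
  The forcing relation for equality of names. The recursion descends along the
  well-founded element relation, so the fixed point defined here is the only one.
\<close>

inductive forces_eq :: "'v::zfc_universe \<Rightarrow> 'v \<Rightarrow> 'v \<Rightarrow> 'v \<Rightarrow> 'v \<Rightarrow> bool" for Q R where
  "(\<And>z s q. vpair z s \<in> elts x \<Longrightarrow> q \<in> extensions Q R p \<Longrightarrow> q \<in> extensions Q R s \<Longrightarrow>
      \<exists>r \<in> extensions Q R q. \<exists>w t. vpair w t \<in> elts y \<and> r \<in> extensions Q R t \<and>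
        forces_eq Q R r z w) \<Longrightarrow>
   (\<And>w t q. vpair w t \<in> elts y \<Longrightarrow> q \<in> extensions Q R p \<Longrightarrow> q \<in> extensions Q R t \<Longrightarrow>
      \<exists>r \<in> extensions Q R q. \<exists>z s. vpair z s \<in> elts x \<and> r \<in> extensions Q R s \<and>
        forces_eq Q R r z w) \<Longrightarrow>
   forces_eq Q R p x y"

definition forces_mem :: "'v::zfc_universe \<Rightarrow> 'v \<Rightarrow> 'v \<Rightarrow> 'v \<Rightarrow> 'v \<Rightarrow> bool" where
  "forces_mem Q R p x y \<longleftrightarrow>
     (\<forall>q \<in> extensions Q R p. \<exists>r \<in> extensions Q R q.
        \<exists>w t. vpair w t \<in> elts y \<and> r \<in> extensions Q R t \<and> forces_eq Q R r x w)"

primrec forces ::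
  "'v::zfc_universe \<Rightarrow> 'v \<Rightarrow> fm \<Rightarrow> 'v \<Rightarrow> (nat \<Rightarrow> 'v) \<Rightarrow> bool" where
  "forces Q R (Mem i j) p e \<longleftrightarrow> forces_mem Q R p (e i) (e j)"
| "forces Q R (Eq i j) p e \<longleftrightarrow> forces_eq Q R p (e i) (e j)"
| "forces Q R (Neg \<phi>) p e \<longleftrightarrow> (\<forall>q \<in> extensions Q R p. \<not> forces Q R \<phi> q e)"
| "forces Q R (And \<phi> \<psi>) p e \<longleftrightarrow> forces Q R \<phi> p e \<and> forces Q R \<psi> p e"
| "forces Q R (All i \<phi>) p e \<longleftrightarrow> (\<forall>x. is_name Q x \<longrightarrow> forces Q R \<phi> p (e(i := x)))"

definition forced :: "'v::zfc_universe \<Rightarrow> 'v \<Rightarrow> fm \<Rightarrow> (nat \<Rightarrow> 'v) \<Rightarrow> bool" where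
  "forced Q R \<phi> e \<longleftrightarrow> (\<forall>p \<in> elts Q. forces Q R \<phi> p e)"

section \<open>Absolutely Hopfian groups\<close>

definition absolutely_hopfian :: "'v::zfc_universe monoid \<Rightarrow> bool" where
  "absolutely_hopfian G \<longleftrightarrow>
     hopfian G \<and>
     (\<forall>Q R. forcing_notion Q R \<longrightarrow>
        forced Q R hopfian_fm (\<lambda>i. check Q (group_assignment G i)))"

end

theory Submission
  imports Defs "HOL-Computational_Algebra.Primes" "HOL-Algebra.Free_Abelian_Groups"
begin

text \<open>
  If a group has a decreasing continuous well-ordered chain of fully invariant subgroups with zero
  intersection and factors of rank one, then a surjective endomorphism is injective: by induction
  along the chain, preimages of its members lie in themselves. To obtain such a chain of
  arbitrary length, identify \<open>W\<close> (well-ordered, infinite) with \<open>W \<times> W\<close>, writing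
  \<open>t = (par t, lst t)\<close>, and let \<open>push \<rho>\<close> send the basis vector \<open>t\<close> of the rational space over \<open>W\<close>
  to \<open>par t\<close> if \<open>lst t < \<rho> (par t)\<close> and to \<open>0\<close> otherwise, for \<open>\<rho> = lst\<close> and \<open>\<rho> = id\<close>. It maps the
  vectors supported on \<open>{t. lst t \<ge> \<alpha>}\<close> onto those supported on \<open>{s. \<rho> s > \<alpha>}\<close>. Hence for endomorphisms
  that commute with both operators, the sets \<open>{lst \<ge> \<alpha>}\<close>, by induction on \<open>\<alpha>\<close>, and then
  \<open>{s. s > \<alpha>}\<close> span invariant subspaces. Commutation is enforced by realizing the
  graphs of the operators as the \<open>p\<close>-divisible parts, for five primes \<open>p\<close>, of a group between two
  copies of the integral and of the rational space over \<open>W\<close>.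

  The argument only extends partial homomorphisms by finitely many points at a time, so it applies to
  a family of them in which such extensions exist, as the family \<open>F\<^sub>r = {(g, h). r \<tturnstile> f(g) = h}\<close> given by a name \<open>f\<close> of
  a surjective endomorphism. Hence the Hopf property persists in forcing extensions.
\<close>

section \<open>Systems of partial homomorphisms\<close>

text \<open>Each \<open>F\<close> records what one stage knows about an unfinished surjective
  endomorphism, and inclusion is growth of knowledge. Products are known at the same stage; a new
  argument or a new preimage may require a later stage. Two later stages may be incompatible, so
  there need be no single total map behind the family.\<close>

locale extension_system =
  fixes G :: "('a, 'b) monoid_scheme" (structure) and \<F> :: "('a \<times> 'a) set set"
  assumes dom: "F \<in> \<F> \<Longrightarrow> (x, y) \<in> F \<Longrightarrow> x \<in> carrier G"
    and ran: "F \<in> \<F> \<Longrightarrow> (x, y) \<in> F \<Longrightarrow> y \<in> carrier G"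
    and unique: "F \<in> \<F> \<Longrightarrow> (x, y) \<in> F \<Longrightarrow> (x, y') \<in> F \<Longrightarrow> y = y'"
    and mult: "F \<in> \<F> \<Longrightarrow> (x, y) \<in> F \<Longrightarrow> (x', y') \<in> F \<Longrightarrow> (x \<otimes> x', y \<otimes> y') \<in> F"
    and extend_dom: "F \<in> \<F> \<Longrightarrow> x \<in> carrier G \<Longrightarrow> \<exists>F'\<in>\<F>. F \<subseteq> F' \<and> (\<exists>y. (x, y) \<in> F')"
    and extend_ran: "F \<in> \<F> \<Longrightarrow> y \<in> carrier G \<Longrightarrow> \<exists>F'\<in>\<F>. F \<subseteq> F' \<and> (\<exists>x. (x, y) \<in> F')"

text \<open>The notion mentions no forcing. The family of facts that conditions decide about a name
  is one instance, and a single surjective endomorphism is another.\<close>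

definition persistently_hopfian :: "('a, 'b) monoid_scheme \<Rightarrow> bool" where
  "persistently_hopfian G \<longleftrightarrow>
     (\<forall>\<F>. extension_system G \<F> \<longrightarrow> (\<forall>F\<in>\<F>. single_valued (F\<inverse>)))"

text \<open>A surjective endomorphism gives the family whose only member is its graph; surjectivity
  is what \<open>extend_ran\<close> asks for.\<close>

lemma persistently_hopfian_imp_hopfian:
  assumes "persistently_hopfian G" "Group.monoid G"
  shows "hopfian G"
  unfolding hopfian_def
proof (intro ballI impI)
  fix f assume f: "f \<in> hom G G" and onto: "f ` carrier G = carrier G"
  interpret Group.monoid G by fact
  let ?F = "{(x, f x) | x. x \<in> carrier G}"
  have "extension_system G {?F}"
    using f onto by unfold_locales (auto simp: hom_def Pi_iff)
  then have "single_valued (?F\<inverse>)"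
    using assms(1) unfolding persistently_hopfian_def by blast
  then show "inj_on f (carrier G)"
    by (auto simp: single_valued_def inj_on_def)
qed

text \<open>A system on \<open>G'\<close> is pulled back along the bijection \<open>h\<close>.
  Closure of \<open>G\<close> under multiplication is a separate assumption because
  \<open>hom\<close> does not provide it.\<close>

lemma persistently_hopfian_iso:
  assumes H: "persistently_hopfian G" and h: "h \<in> hom G G'" "bij_betw h (carrier G) (carrier G')"
    and clos: "\<And>x y. x \<in> carrier G \<Longrightarrow> y \<in> carrier G \<Longrightarrow> x \<otimes>\<^bsub>G\<^esub> y \<in> carrier G"
  shows "persistently_hopfian G'"
  unfolding persistently_hopfian_def
proof (intro allI impI ballI)
  fix \<F>' F0
  assume sys: "extension_system G' \<F>'" and F0: "F0 \<in> \<F>'"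
  define pull where "pull F = {(x, y) \<in> carrier G \<times> carrier G. (h x, h y) \<in> F}" for F
  have inj: "inj_on h (carrier G)" and im: "h ` carrier G = carrier G'"
    using h(2) by (auto simp: bij_betw_def)
  have mult: "h (x \<otimes>\<^bsub>G\<^esub> y) = h x \<otimes>\<^bsub>G'\<^esub> h y" if "x \<in> carrier G" "y \<in> carrier G" for x y
    using h(1) that by (auto simp: hom_def)
  interpret G': extension_system G' \<F>' by (rule sys)
  have "extension_system G (pull ` \<F>')"
  proof
    fix F1 assume "F1 \<in> pull ` \<F>'"
    then obtain F where F: "F \<in> \<F>'" "F1 = pull F" by blast
    show "(x, y) \<in> F1 \<Longrightarrow> x \<in> carrier G" "(x, y) \<in> F1 \<Longrightarrow> y \<in> carrier G" for x y
      by (auto simp: F pull_def)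
    show "y = y'" if "(x, y) \<in> F1" "(x, y') \<in> F1" for x y y'
      using G'.unique[OF F(1)] inj that unfolding F pull_def inj_on_def by blast
    show "(x \<otimes>\<^bsub>G\<^esub> x', y \<otimes>\<^bsub>G\<^esub> y') \<in> F1" if "(x, y) \<in> F1" "(x', y') \<in> F1" for x y x' y'
      using G'.mult[OF F(1)] that by (auto simp: F pull_def mult clos)
    have mono: "F \<subseteq> F' \<Longrightarrow> F1 \<subseteq> pull F'" for F' by (auto simp: F pull_def)
    show "\<exists>F'\<in>pull ` \<F>'. F1 \<subseteq> F' \<and> (\<exists>y. (x, y) \<in> F')" if x: "x \<in> carrier G" for x
    proof -
      obtain F' z where F': "F' \<in> \<F>'" "F \<subseteq> F'" "(h x, z) \<in> F'"
        using G'.extend_dom[OF F(1)] im x by blast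
      moreover obtain y where "y \<in> carrier G" "z = h y"
        using G'.ran[OF F'(1,3)] im by blast
      ultimately have "(x, y) \<in> pull F'" using x by (auto simp: pull_def)
      then show ?thesis using F' mono by blast
    qed
    show "\<exists>F'\<in>pull ` \<F>'. F1 \<subseteq> F' \<and> (\<exists>x. (x, y) \<in> F')" if y: "y \<in> carrier G" for y
    proof -
      obtain F' z where F': "F' \<in> \<F>'" "F \<subseteq> F'" "(z, h y) \<in> F'"
        using G'.extend_ran[OF F(1)] im y by blast
      moreover obtain x where "x \<in> carrier G" "z = h x"
        using G'.dom[OF F'(1,3)] im by blast
      ultimately have "(x, y) \<in> pull F'" using y by (auto simp: pull_def)
      then show ?thesis using F' mono by blast
    qed
  qed
  then have sv: "single_valued ((pull F0)\<inverse>)"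
    using H F0 unfolding persistently_hopfian_def by blast
  show "single_valued (F0\<inverse>)"
  proof (rule single_valuedI)
    fix z x y assume "(z, x) \<in> F0\<inverse>" "(z, y) \<in> F0\<inverse>"
    then have F0': "(x, z) \<in> F0" "(y, z) \<in> F0" by auto
    then have "x \<in> h ` carrier G" "y \<in> h ` carrier G" "z \<in> h ` carrier G"
      using G'.dom[OF F0] G'.ran[OF F0] im by blast+
    then obtain a b c where "a \<in> carrier G" "b \<in> carrier G" "c \<in> carrier G"
      "x = h a" "y = h b" "z = h c"
      by blast
    with sv F0' show "x = y" by (auto simp: pull_def single_valued_def)
  qed
qed

section \<open>Operators on a rational vector space\<close>

text \<open>The order lives on the whole type, whereas \<open>code\<close>, \<open>par\<close> and
  \<open>lst\<close> describe a bijection between \<open>W \<times> W\<close> and \<open>W\<close>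
  and are unconstrained elsewhere. Order and pairing need not be compatible.\<close>

locale indexed_pairing =
  fixes W :: "'i set" and lt :: "'i \<Rightarrow> 'i \<Rightarrow> bool" (infix "\<triangleleft>" 50)
    and code :: "'i \<Rightarrow> 'i \<Rightarrow> 'i" and par lst :: "'i \<Rightarrow> 'i"
  assumes wf: "wf {(x, y). x \<triangleleft> y}"
    and trans: "x \<triangleleft> y \<Longrightarrow> y \<triangleleft> z \<Longrightarrow> x \<triangleleft> z"
    and linear: "x \<triangleleft> y \<or> x = y \<or> y \<triangleleft> x"
    and code: "s \<in> W \<Longrightarrow> \<gamma> \<in> W \<Longrightarrow> code s \<gamma> \<in> W \<and> par (code s \<gamma>) = s \<and> lst (code s \<gamma>) = \<gamma>"
    and decode: "t \<in> W \<Longrightarrow> par t \<in> W \<and> lst t \<in> W \<and> code (par t) (lst t) = t"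
begin

lemma irrefl: "\<not> x \<triangleleft> x"
  using wf by (auto dest: wf_not_sym)

definition vecs :: "('i \<Rightarrow> rat) set" where
  "vecs = {v. finite {t. v t \<noteq> 0} \<and> {t. v t \<noteq> 0} \<subseteq> W}"

definition push :: "('i \<Rightarrow> 'i) \<Rightarrow> ('i \<Rightarrow> rat) \<Rightarrow> 'i \<Rightarrow> rat" where
  "push \<rho> v s = (\<Sum>t | v t \<noteq> 0 \<and> par t = s \<and> lst t \<triangleleft> \<rho> s. v t)"

text \<open>Supports change under addition and scaling. A common finite index set, with the side
  condition moved into the summand, makes linearity a termwise matter.\<close>

lemma push_eq:
  assumes "finite T" "{t. v t \<noteq> 0} \<subseteq> T"
  shows "push \<rho> v s = (\<Sum>t\<in>T. if par t = s \<and> lst t \<triangleleft> \<rho> s then v t else 0)"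
  unfolding push_def using assms
  by (subst sum.inter_filter[symmetric]) (auto intro!: sum.mono_neutral_left)

lemma push_add:
  assumes "v \<in> vecs" "w \<in> vecs"
  shows "push \<rho> (\<lambda>t. v t + w t) s = push \<rho> v s + push \<rho> w s"
proof -
  let ?T = "{t. v t \<noteq> 0} \<union> {t. w t \<noteq> 0}"
  have T: "finite ?T" using assms by (auto simp: vecs_def)
  show ?thesis
    by (subst (1 2 3) push_eq[OF T]) (auto simp flip: sum.distrib intro!: sum.cong)
qed

lemma push_scale:
  assumes "v \<in> vecs"
  shows "push \<rho> (\<lambda>t. c * v t) s = c * push \<rho> v s"
proof -
  have T: "finite {t. v t \<noteq> 0}" using assms by (auto simp: vecs_def)
  show ?thesis
    by (subst (1 2) push_eq[OF T]) (auto simp: sum_distrib_left intro!: sum.cong)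
qed

lemma vecs_add: "v \<in> vecs \<Longrightarrow> w \<in> vecs \<Longrightarrow> (\<lambda>t. v t + w t) \<in> vecs"
proof -
  assume "v \<in> vecs" "w \<in> vecs"
  moreover have "{t. v t + w t \<noteq> 0} \<subseteq> {t. v t \<noteq> 0} \<union> {t. w t \<noteq> 0}" by auto
  ultimately show ?thesis
    unfolding vecs_def mem_Collect_eq by (meson finite_UnI finite_subset le_sup_iff order_trans)
qed

lemma vecs_scale: "v \<in> vecs \<Longrightarrow> (\<lambda>t. c * v t) \<in> vecs"
  unfolding vecs_def by (auto intro: finite_subset[of _ "{t. v t \<noteq> 0}"])

lemma vecs_zero: "(\<lambda>t. 0) \<in> vecs"
  by (simp add: vecs_def)

lemma vecs_push:
  assumes "v \<in> vecs"
  shows "push \<rho> v \<in> vecs"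
proof -
  have "{s. push \<rho> v s \<noteq> 0} \<subseteq> par ` {t. v t \<noteq> 0}"
    unfolding push_def by (auto elim!: sum.not_neutral_contains_not_neutral)
  then show ?thesis
    using assms decode unfolding vecs_def by (auto intro: finite_subset)
qed

lemma push_nonzeroE:
  assumes "push \<rho> v s \<noteq> 0"
  obtains t where "v t \<noteq> 0" "par t = s" "lst t \<triangleleft> \<rho> s"
  using assms unfolding push_def by (auto elim!: sum.not_neutral_contains_not_neutral)

text \<open>The preimage puts the entry of \<open>v\<close> at \<open>s\<close> onto the single
  index \<open>code s \<alpha>\<close>; the hypothesis
  \<open>\<alpha> \<triangleleft> \<rho> s\<close> is what makes \<open>push \<rho>\<close> keep
  that entry.\<close>

lemma push_section:
  assumes v: "v \<in> vecs" "\<And>s. v s \<noteq> 0 \<Longrightarrow> \<alpha> \<triangleleft> \<rho> s" and \<alpha>: "\<alpha> \<in> W"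
  obtains u where "u \<in> vecs" "push \<rho> u = v" "\<And>t. u t \<noteq> 0 \<Longrightarrow> lst t = \<alpha>"
proof
  define u where "u t = (if t \<in> W \<and> lst t = \<alpha> then v (par t) else 0)" for t
  have "{t. u t \<noteq> 0} \<subseteq> (\<lambda>s. code s \<alpha>) ` {s. v s \<noteq> 0}"
  proof
    fix t assume "t \<in> {t. u t \<noteq> 0}"
    then have "t \<in> W" "lst t = \<alpha>" "v (par t) \<noteq> 0"
      by (auto simp: u_def split: if_splits)
    then have "t = code (par t) \<alpha>" "v (par t) \<noteq> 0" using decode[of t] by auto
    then show "t \<in> (\<lambda>s. code s \<alpha>) ` {s. v s \<noteq> 0}" by blast
  qed
  moreover have "finite {s. v s \<noteq> 0}" using v by (simp add: vecs_def)
  ultimately have "finite {t. u t \<noteq> 0}" using finite_subset finite_imageI by metis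
  then show "u \<in> vecs" by (auto simp: vecs_def u_def)
  show "u t \<noteq> 0 \<Longrightarrow> lst t = \<alpha>" for t by (simp add: u_def split: if_splits)
  show "push \<rho> u = v"
  proof
    fix s
    have "t = code s \<alpha>" if "u t \<noteq> 0" "par t = s" for t
      using decode[of t] that by (auto simp: u_def split: if_splits)
    then have sub: "{t. u t \<noteq> 0 \<and> par t = s \<and> lst t \<triangleleft> \<rho> s} \<subseteq> {code s \<alpha>}" by blast
    show "push \<rho> u s = v s"
    proof (cases "v s = 0")
      case True
      then have "{t. u t \<noteq> 0 \<and> par t = s \<and> lst t \<triangleleft> \<rho> s} = {}"
        by (auto simp: u_def split: if_splits)
      then show ?thesis unfolding push_def using True by (simp only: sum.empty)
    next
      case False
      then have "s \<in> W" "\<alpha> \<triangleleft> \<rho> s" using v by (auto simp: vecs_def)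
      then have "u (code s \<alpha>) = v s" "par (code s \<alpha>) = s" "lst (code s \<alpha>) = \<alpha>"
        using code[of s \<alpha>] \<alpha> by (auto simp: u_def)
      moreover from this have "{t. u t \<noteq> 0 \<and> par t = s \<and> lst t \<triangleleft> \<rho> s} = {code s \<alpha>}"
        using sub False \<open>\<alpha> \<triangleleft> \<rho> s\<close> by auto
      ultimately show ?thesis unfolding push_def by simp
    qed
  qed
qed

definition unit :: "'i \<Rightarrow> 'i \<Rightarrow> rat" where
  "unit x = (\<lambda>t. if t = x then 1 else 0)"

lemma unit_vecs: "x \<in> W \<Longrightarrow> unit x \<in> vecs"
  by (auto simp: vecs_def unit_def)

end

text \<open>Linear counterpart of \<open>extension_system\<close>: sums are known at once, while
  scalar multiples and images under the two operators may appear only at a later stage.\<close>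

locale vec_system = indexed_pairing +
  fixes \<E> :: "(('a \<Rightarrow> rat) \<times> ('a \<Rightarrow> rat)) set set"
  assumes dom: "E \<in> \<E> \<Longrightarrow> (v, v') \<in> E \<Longrightarrow> v \<in> vecs"
    and ran: "E \<in> \<E> \<Longrightarrow> (v, v') \<in> E \<Longrightarrow> v' \<in> vecs"
    and unique: "E \<in> \<E> \<Longrightarrow> (v, v') \<in> E \<Longrightarrow> (v, v'') \<in> E \<Longrightarrow> v' = v''"
    and add: "E \<in> \<E> \<Longrightarrow> (v, v') \<in> E \<Longrightarrow> (w, w') \<in> E \<Longrightarrow>
      ((\<lambda>t. v t + w t), (\<lambda>t. v' t + w' t)) \<in> E"
    and scale: "E \<in> \<E> \<Longrightarrow> (v, v') \<in> E \<Longrightarrow>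
      \<exists>E'\<in>\<E>. E \<subseteq> E' \<and> ((\<lambda>t. c * v t), (\<lambda>t. c * v' t)) \<in> E'"
    and push: "E \<in> \<E> \<Longrightarrow> (v, v') \<in> E \<Longrightarrow> \<rho> \<in> {id, lst} \<Longrightarrow>
      \<exists>E'\<in>\<E>. E \<subseteq> E' \<and> (push \<rho> v, push \<rho> v') \<in> E'"
    and extend_dom: "E \<in> \<E> \<Longrightarrow> v \<in> vecs \<Longrightarrow> \<exists>E'\<in>\<E>. E \<subseteq> E' \<and> (\<exists>v'. (v, v') \<in> E')"
    and extend_ran: "E \<in> \<E> \<Longrightarrow> v' \<in> vecs \<Longrightarrow> \<exists>E'\<in>\<E>. E \<subseteq> E' \<and> (\<exists>v. (v, v') \<in> E')"
begin

definition invariant :: "('a \<Rightarrow> bool) \<Rightarrow> bool" where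
  "invariant S \<longleftrightarrow>
     (\<forall>E\<in>\<E>. \<forall>v v'. (v, v') \<in> E \<longrightarrow> (\<forall>t. v t \<noteq> 0 \<longrightarrow> S t) \<longrightarrow> (\<forall>t. v' t \<noteq> 0 \<longrightarrow> S t))"

lemma invariantD:
  "invariant S \<Longrightarrow> E \<in> \<E> \<Longrightarrow> (v, v') \<in> E \<Longrightarrow> (\<And>t. v t \<noteq> 0 \<Longrightarrow> S t) \<Longrightarrow> v' t \<noteq> 0 \<Longrightarrow> S t"
  unfolding invariant_def by blast

text \<open>Vectors are supported in \<open>W\<close>, so an index set matters only through its
  trace on \<open>W\<close>, and a support condition on an intersection splits into separate
  conditions.\<close>

lemma invariant_Inter:
  assumes "\<And>\<beta>. \<beta> \<in> B \<Longrightarrow> invariant (S \<beta>)" and "\<And>t. t \<in> W \<Longrightarrow> S' t \<longleftrightarrow> (\<forall>\<beta>\<in>B. S \<beta> t)"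
  shows "invariant S'"
  unfolding invariant_def
proof (intro ballI allI impI)
  fix E v v' t
  assume E: "E \<in> \<E>" "(v, v') \<in> E" and v: "\<forall>t. v t \<noteq> 0 \<longrightarrow> S' t" and t: "v' t \<noteq> 0"
  have W: "\<And>t. v t \<noteq> 0 \<Longrightarrow> t \<in> W" "t \<in> W"
    using dom[OF E] ran[OF E] t by (auto simp: vecs_def)
  have "S \<beta> t" if "\<beta> \<in> B" for \<beta>
    using invariantD[OF assms(1)[OF that] E _ t] v W(1) assms(2) that by blast
  then show "S' t" using assms(2) W by blast
qed

text \<open>A vector supported on \<open>\<alpha> \<triangleleft> \<rho> s\<close> is
  \<open>push \<rho>\<close> of one supported on \<open>lst t = \<alpha>\<close>. Images of the
  latter have no entries with \<open>lst t \<triangleleft> \<alpha>\<close>, and an entry that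
  \<open>push \<rho>\<close> moves from \<open>t\<close> to \<open>s\<close> satisfies
  \<open>lst t \<triangleleft> \<rho> s\<close>.\<close>

lemma invariant_push:
  assumes "\<alpha> \<in> W" "invariant (\<lambda>t. \<not> lst t \<triangleleft> \<alpha>)" "\<rho> \<in> {id, lst}"
  shows "invariant (\<lambda>s. \<alpha> \<triangleleft> \<rho> s)"
  unfolding invariant_def
proof (intro ballI allI impI)
  fix E v v' s
  assume E: "E \<in> \<E>" "(v, v') \<in> E" and v: "\<forall>t. v t \<noteq> 0 \<longrightarrow> \<alpha> \<triangleleft> \<rho> t" and s: "v' s \<noteq> 0"
  obtain u where u: "u \<in> vecs" "push \<rho> u = v" "\<And>t. u t \<noteq> 0 \<Longrightarrow> lst t = \<alpha>"
    using push_section[of v \<alpha> \<rho>] dom[OF E] v assms(1) by blast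
  obtain E' u' where E': "E' \<in> \<E>" "E \<subseteq> E'" "(u, u') \<in> E'" using extend_dom[OF E(1) u(1)] by blast
  obtain E'' where E'': "E'' \<in> \<E>" "E' \<subseteq> E''" "(push \<rho> u, push \<rho> u') \<in> E''"
    using push[OF E'(1,3) assms(3)] by blast
  have "v' = push \<rho> u'" using unique[OF E''(1)] E'' E' E u(2) by blast
  then obtain t where t: "u' t \<noteq> 0" "par t = s" "lst t \<triangleleft> \<rho> s"
    using s push_nonzeroE by metis
  have "\<not> lst t \<triangleleft> \<alpha>" using invariantD[OF assms(2) E'(1,3) _ t(1)] u(3) irrefl by blast
  then show "\<alpha> \<triangleleft> \<rho> s" using t(3) linear trans by blast
qed

text \<open>Apply \<open>invariant_push\<close> with \<open>\<rho> = lst\<close> to every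
  \<open>\<beta>\<close> below \<open>\<alpha>\<close> and intersect. Least, successor and limit
  positions are covered alike; at the least one the intersection is empty and imposes
  nothing.\<close>

lemma invariant_final_segments:
  assumes "\<alpha> \<in> W"
  shows "invariant (\<lambda>t. \<not> lst t \<triangleleft> \<alpha>)"
  using wf assms
proof (induction \<alpha> rule: wf_induct_rule)
  case (less \<alpha>)
  have "invariant (\<lambda>t. \<beta> \<triangleleft> lst t)" if "\<beta> \<in> {\<beta> \<in> W. \<beta> \<triangleleft> \<alpha>}" for \<beta>
    using invariant_push[of \<beta> lst] less.IH that by auto
  then show ?case
  proof (rule invariant_Inter)
    show "(\<not> lst t \<triangleleft> \<alpha>) \<longleftrightarrow> (\<forall>\<beta>\<in>{\<beta> \<in> W. \<beta> \<triangleleft> \<alpha>}. \<beta> \<triangleleft> lst t)" if "t \<in> W" for t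
      using decode[OF that] linear trans irrefl by blast
  qed
qed

text \<open>The choice \<open>\<rho> = id\<close> converts information about last coordinates into
  information about the indices themselves, where the two segments at \<open>\<alpha>\<close> differ
  by a single basis vector.\<close>

lemma invariant_above:
  assumes "\<alpha> \<in> W"
  shows "invariant (\<lambda>s. \<alpha> \<triangleleft> s)" "invariant (\<lambda>s. \<not> s \<triangleleft> \<alpha>)"
proof -
  have *: "invariant (\<lambda>s. \<beta> \<triangleleft> s)" if "\<beta> \<in> W" for \<beta>
    using invariant_push[of \<beta> id] invariant_final_segments that by auto
  then show "invariant (\<lambda>s. \<alpha> \<triangleleft> s)" using assms .
  show "invariant (\<lambda>s. \<not> s \<triangleleft> \<alpha>)"
  proof (rule invariant_Inter)
    show "invariant (\<lambda>s. \<beta> \<triangleleft> s)" if "\<beta> \<in> {\<beta> \<in> W. \<beta> \<triangleleft> \<alpha>}" for \<beta>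
      using that * by blast
    show "(\<not> t \<triangleleft> \<alpha>) \<longleftrightarrow> (\<forall>\<beta>\<in>{\<beta> \<in> W. \<beta> \<triangleleft> \<alpha>}. \<beta> \<triangleleft> t)" if "t \<in> W" for t
      using that linear trans irrefl by blast
  qed
qed

text \<open>Modulo vectors supported strictly above \<open>x\<close>, those supported from
  \<open>x\<close> on form a line. The system acts on it by the scalar \<open>e x\<close>, which is
  nonzero because \<open>unit x\<close> has a preimage.\<close>

lemma lead_coefficient:
  assumes x: "x \<in> W"
  shows "E \<in> \<E> \<Longrightarrow> (v, w) \<in> E \<Longrightarrow> (\<And>y. y \<triangleleft> x \<or> y = x \<Longrightarrow> w y = 0) \<Longrightarrow> v x = 0"
  using wf x
proof (induction x arbitrary: E v w rule: wf_induct_rule)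
  case (less x)
  \<comment> \<open>The induction hypothesis shows that an argument cannot start below
    \<open>x\<close> unless its image does.\<close>
  have low: "z y = 0" if "F \<in> \<E>" "(z, z') \<in> F" "\<And>y. y \<triangleleft> x \<Longrightarrow> z' y = 0" "y \<triangleleft> x" for F z z' y
  proof (cases "y \<in> W")
    case True
    show ?thesis by (rule less.IH[of y F z z']) (use that trans True in auto)
  next
    case False
    then show ?thesis using dom[OF that(1,2)] by (auto simp: vecs_def)
  qed
  obtain E1 u where E1: "E1 \<in> \<E>" "E \<subseteq> E1" "(u, unit x) \<in> E1"
    using extend_ran[OF less.prems(1) unit_vecs[OF \<open>x \<in> W\<close>]] by blast
  obtain E2 e where E2: "E2 \<in> \<E>" "E1 \<subseteq> E2" "(unit x, e) \<in> E2"
    using extend_dom[OF E1(1) unit_vecs[OF \<open>x \<in> W\<close>]] by blast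
  have lin: "z' x = z x * e x" if z: "(z, z') \<in> E2" "\<And>y. y \<triangleleft> x \<Longrightarrow> z' y = 0" for z z'
  proof -
    \<comment> \<open>Subtracting \<open>z x\<close> times \<open>unit x\<close> leaves a vector
      supported strictly above \<open>x\<close>; its image is supported there too, which determines
      the entry of \<open>z'\<close> at \<open>x\<close>.\<close>
    obtain E3 where E3: "E3 \<in> \<E>" "E2 \<subseteq> E3" "((\<lambda>t. - z x * unit x t), (\<lambda>t. - z x * e t)) \<in> E3"
      using scale[OF E2(1,3)] by blast
    then have *: "((\<lambda>t. z t + - z x * unit x t), (\<lambda>t. z' t + - z x * e t)) \<in> E3"
      using add[OF E3(1)] z(1) by blast
    have "z' x + - z x * e x = 0"
    proof (rule ccontr)
      assume nz: "\<not> ?thesis"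
      have "x \<triangleleft> t" if "z t + - z x * unit x t \<noteq> 0" for t
        using that low[OF E2(1) z] linear[of x t] irrefl by (auto simp: unit_def split: if_splits)
      then have "x \<triangleleft> x"
        using invariantD[OF invariant_above(1)[OF \<open>x \<in> W\<close>] E3(1) *, of x] nz by blast
      then show False using irrefl by blast
    qed
    then show ?thesis by simp
  qed
  have "(u, unit x) \<in> E2" "(v, w) \<in> E2" using E1 E2 less.prems by blast+
  \<comment> \<open>The preimage \<open>u\<close> of \<open>unit x\<close> shows that
    \<open>e x\<close> is invertible.\<close>
  have "unit x x = u x * e x"
    by (rule lin) (use \<open>(u, unit x) \<in> E2\<close> irrefl in \<open>auto simp: unit_def\<close>)
  then have "u x * e x = 1" by (simp add: unit_def)
  moreover have "w x = v x * e x"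
    by (rule lin) (use \<open>(v, w) \<in> E2\<close> less.prems in auto)
  then have "v x * e x = 0" using less.prems by simp
  ultimately show ?case by auto
qed

lemma vec_system_kernel:
  assumes "E \<in> \<E>" "(v, \<lambda>t. 0) \<in> E"
  shows "v = (\<lambda>t. 0)"
proof
  fix x show "v x = 0"
    using lead_coefficient[OF _ assms] dom[OF assms] by (cases "x \<in> W") (auto simp: vecs_def)
qed

end

section \<open>The group\<close>

definition p_integral :: "nat \<Rightarrow> rat \<Rightarrow> bool" where
  "p_integral p r \<longleftrightarrow> (\<exists>b::int. \<not> int p dvd b \<and> of_int b * r \<in> \<int>)"

lemma p_integral_Ints: "prime p \<Longrightarrow> r \<in> \<int> \<Longrightarrow> p_integral p r"
  unfolding p_integral_def by (rule exI[of _ 1]) (auto simp: not_prime_unit)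

lemma p_integral_add:
  assumes p: "prime p" and r: "p_integral p r" "p_integral p s"
  shows "p_integral p (r + s)"
proof -
  obtain b c where b: "\<not> int p dvd b" "of_int b * r \<in> \<int>" and c: "\<not> int p dvd c" "of_int c * s \<in> \<int>"
    using r by (auto simp: p_integral_def)
  have "of_int (b * c) * (r + s) = of_int c * (of_int b * r) + of_int b * (of_int c * s)"
    by (simp add: algebra_simps)
  also have "\<dots> \<in> \<int>"
    by (rule Ints_add[OF Ints_mult[OF Ints_of_int b(2)] Ints_mult[OF Ints_of_int c(2)]])
  finally have "of_int (b * c) * (r + s) \<in> \<int>" .
  moreover have "\<not> int p dvd b * c" using b c p by (simp add: prime_dvd_mult_iff)
  ultimately show ?thesis unfolding p_integral_def by blast
qed

lemma p_integral_mult_int: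
  assumes "p_integral p r"
  shows "p_integral p (of_int a * r)"
proof -
  obtain b where b: "\<not> int p dvd b" "of_int b * r \<in> \<int>" using assms by (auto simp: p_integral_def)
  have "of_int b * (of_int a * r) = of_int a * (of_int b * r)" by simp
  also have "\<dots> \<in> \<int>" by (rule Ints_mult[OF Ints_of_int b(2)])
  finally show ?thesis using b unfolding p_integral_def by blast
qed

text \<open>A prime other than \<open>p\<close> is a unit of the localization at
  \<open>p\<close>.\<close>

lemma p_integral_divide:
  assumes "prime p" "prime q" "p \<noteq> q" "p_integral p r"
  shows "p_integral p (r / of_nat q ^ k)"
proof -
  obtain b where b: "\<not> int p dvd b" "of_int b * r \<in> \<int>" using assms by (auto simp: p_integral_def)
  have "\<not> int p dvd int q ^ k"
    using assms by (metis of_nat_dvd_iff of_nat_power prime_dvd_power primes_dvd_imp_eq)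
  then have "\<not> int p dvd b * int q ^ k" using b assms(1) by (simp add: prime_dvd_mult_iff)
  moreover have "of_int (b * int q ^ k) * (r / of_nat q ^ k) = of_int b * r"
    using assms(2) by (simp add: prime_gt_0_nat)
  ultimately show ?thesis using b unfolding p_integral_def by metis
qed

text \<open>Zero is the only infinitely \<open>p\<close>-divisible element of the localization. For
  \<open>r = a / d\<close>, divisibility with exponent \<open>k = |a|\<close> would force
  \<open>p ^ k\<close> to divide \<open>a\<close>, although \<open>k < p ^ k\<close>.\<close>

lemma p_integral_all_powers:
  assumes p: "prime p" and r: "\<And>k. p_integral p (r / of_nat p ^ k)"
  shows "r = 0"
proof (rule ccontr)
  assume "r \<noteq> 0"
  obtain a d where ad: "r = of_int a / of_int d" "d > 0"
    by (metis quotient_of_denom_pos quotient_of_div surj_pair)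
  have "a \<noteq> 0" using \<open>r \<noteq> 0\<close> ad by auto
  define k where "k = nat \<bar>a\<bar>"
  obtain b m where b: "\<not> int p dvd b" "of_int b * (r / of_nat p ^ k) = of_int m"
    using r[of k] by (auto simp: p_integral_def elim: Ints_cases)
  then have "(of_int (b * a) :: rat) = of_int (m * d * int p ^ k)"
    using ad prime_gt_0_nat[OF p] by (simp add: field_simps)
  then have "b * a = m * d * int p ^ k" by (simp only: of_int_eq_iff)
  then have "int p ^ k dvd b * a" by simp
  moreover have "coprime (int p ^ k) b" using b(1) p by (simp add: prime_imp_coprime)
  ultimately have "int p ^ k dvd a" by (simp add: coprime_dvd_mult_right_iff)
  then have "int p ^ k \<le> \<bar>a\<bar>" using dvd_imp_le_int[OF \<open>a \<noteq> 0\<close>] by fastforce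
  moreover have "k < p ^ k" using prime_gt_1_nat[OF p] by (simp add: power_gt_expt)
  ultimately show False by (simp add: k_def nat_less_iff)
qed

text \<open>Applied to the entries of a vector of finite support, this yields a positive integer
  multiple with integral entries.\<close>

lemma common_denominator:
  assumes "finite S"
  shows "\<exists>N::nat. N > 0 \<and> (\<forall>r\<in>S. of_nat N * (r::rat) \<in> \<int>)"
  using assms
proof induction
  case empty
  show ?case by auto
next
  case (insert r S)
  then obtain N :: nat where N: "N > 0" "\<forall>s\<in>S. of_nat N * s \<in> \<int>" by blast
  obtain a d where ad: "r = of_int a / of_int d" "d > 0"
    by (metis quotient_of_denom_pos quotient_of_div surj_pair)
  have "of_nat (N * nat d) * s \<in> \<int>" if "s \<in> insert r S" for s
  proof (cases "s = r")
    case True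
    have "of_nat (N * nat d) * r = of_int (int N * a)" using ad by simp
    then show ?thesis using True by (metis Ints_of_int)
  next
    case False
    then have "of_nat N * s \<in> \<int>" using N that by blast
    then have "of_nat (nat d) * (of_nat N * s) \<in> \<int>" by (rule Ints_mult[OF Ints_of_nat])
    then show ?thesis by (simp add: ac_simps)
  qed
  moreover have "N * nat d > 0" using N ad by simp
  ultimately show ?case by blast
qed

section \<open>The group and its divisible parts\<close>

context indexed_pairing
begin

definition labels :: "nat set" where
  "labels = {2, 3, 5, 7, 11}"

text \<open>The \<open>p\<close>-divisible part of the group below is the kernel of \<open>defect p\<close>, for
  \<open>p \<in> labels\<close>: the first summand, the second summand, the diagonal and the graphs
  of the two operators \<open>push lst\<close> and \<open>push id\<close>.\<close>

definition defect :: "nat \<Rightarrow> ('i \<Rightarrow> rat) \<times> ('i \<Rightarrow> rat) \<Rightarrow> 'i \<Rightarrow> rat" where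
  "defect p g t =
    (if p = 2 then snd g t
     else if p = 3 then fst g t
     else if p = 5 then fst g t - snd g t
     else if p = 7 then push lst (fst g) t - snd g t
     else push id (fst g) t - snd g t)"

definition gadd :: "('i \<Rightarrow> rat) \<times> ('i \<Rightarrow> rat) \<Rightarrow> ('i \<Rightarrow> rat) \<times> ('i \<Rightarrow> rat) \<Rightarrow> ('i \<Rightarrow> rat) \<times> ('i \<Rightarrow> rat)" where
  "gadd g h = (\<lambda>t. fst g t + fst h t, \<lambda>t. snd g t + snd h t)"

definition gscale :: "rat \<Rightarrow> ('i \<Rightarrow> rat) \<times> ('i \<Rightarrow> rat) \<Rightarrow> ('i \<Rightarrow> rat) \<times> ('i \<Rightarrow> rat)" where
  "gscale c g = (\<lambda>t. c * fst g t, \<lambda>t. c * snd g t)"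

text \<open>Each prime in \<open>labels\<close> restricts one linear image of the pair, and no other
  prime restricts anything. Individual entries need not be integral, which leaves room for the
  divisible parts.\<close>

definition hopf_group :: "(('i \<Rightarrow> rat) \<times> ('i \<Rightarrow> rat)) monoid" where
  "hopf_group =
    \<lparr>carrier = {g \<in> vecs \<times> vecs. \<forall>p\<in>labels. \<forall>t. p_integral p (defect p g t)},
     monoid.mult = gadd, one = (\<lambda>t. 0, \<lambda>t. 0)\<rparr>"

abbreviation H_carrier where "H_carrier \<equiv> carrier hopf_group"

lemma hopf_group_simps [simp]:
  "(\<otimes>\<^bsub>hopf_group\<^esub>) = gadd" "\<one>\<^bsub>hopf_group\<^esub> = (\<lambda>t. 0, \<lambda>t. 0)"
  by (simp_all add: hopf_group_def)

lemma in_carrier_iff: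
  "g \<in> H_carrier \<longleftrightarrow>
    fst g \<in> vecs \<and> snd g \<in> vecs \<and> (\<forall>p\<in>labels. \<forall>t. p_integral p (defect p g t))"
  by (auto simp: hopf_group_def mem_Times_iff)

lemma primes: "p \<in> labels \<Longrightarrow> prime p"
  unfolding labels_def by (auto simp: two_is_prime_nat)

lemma defect_add:
  "fst g \<in> vecs \<Longrightarrow> fst h \<in> vecs \<Longrightarrow> defect p (gadd g h) t = defect p g t + defect p h t"
  by (simp add: defect_def gadd_def push_add)

lemma defect_scale: "fst g \<in> vecs \<Longrightarrow> defect p (gscale c g) t = c * defect p g t"
  by (simp add: defect_def gscale_def push_scale algebra_simps)

lemma gadd_carrier: "g \<in> H_carrier \<Longrightarrow> h \<in> H_carrier \<Longrightarrow> gadd g h \<in> H_carrier"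
  unfolding in_carrier_iff
  by (simp add: defect_add p_integral_add primes) (simp add: gadd_def vecs_add)

lemma gscale_int_carrier: "g \<in> H_carrier \<Longrightarrow> gscale (of_int a) g \<in> H_carrier"
  unfolding in_carrier_iff
  by (simp add: defect_scale p_integral_mult_int) (simp add: gscale_def vecs_scale)

lemma gscale_vecs:
  "fst g \<in> vecs \<Longrightarrow> fst (gscale c g) \<in> vecs" "snd g \<in> vecs \<Longrightarrow> snd (gscale c g) \<in> vecs"
  by (simp_all add: gscale_def vecs_scale)

lemma gscale_gscale [simp]: "gscale c (gscale d g) = gscale (c * d) g"
  by (simp add: gscale_def mult.assoc)

lemma gscale_one [simp]: "gscale 1 g = g"
  by (simp add: gscale_def)

lemma gscale_add_left: "gadd (gscale c g) (gscale d g) = gscale (c + d) g"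
  by (simp add: gscale_def gadd_def algebra_simps)

lemma integral_in_carrier:
  assumes "fst g \<in> vecs" "snd g \<in> vecs" "\<And>t. fst g t \<in> \<int>" "\<And>t. snd g t \<in> \<int>"
  shows "g \<in> H_carrier"
proof -
  have "push \<rho> (fst g) t \<in> \<int>" for \<rho> t
    unfolding push_def using assms by (intro Ints_sum)
  then have "defect p g t \<in> \<int>" for p t
    using assms by (auto simp: defect_def)
  then show ?thesis
    using assms primes p_integral_Ints unfolding in_carrier_iff by blast
qed

text \<open>The conclusion covers every multiple of \<open>N\<close>, so that several such
  requirements can later be met at once by a product.\<close>

lemma multiple_in_carrier:
  assumes "fst g \<in> vecs" "snd g \<in> vecs"
  obtains N :: nat where "N > 0" "\<And>m. N dvd m \<Longrightarrow> gscale (of_nat m) g \<in> H_carrier"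
proof -
  have "range (fst g) \<subseteq> insert 0 (fst g ` {t. fst g t \<noteq> 0})"
    "range (snd g) \<subseteq> insert 0 (snd g ` {t. snd g t \<noteq> 0})" by auto
  moreover have "finite {t. fst g t \<noteq> 0}" "finite {t. snd g t \<noteq> 0}"
    using assms by (auto simp: vecs_def)
  ultimately have "finite (range (fst g) \<union> range (snd g))"
    by (meson finite_UnI finite_imageI finite_insert finite_subset)
  from common_denominator[OF this] obtain N :: nat where
    N: "N > 0" "\<And>t. of_nat N * fst g t \<in> \<int>" "\<And>t. of_nat N * snd g t \<in> \<int>" by blast
  have "gscale (of_nat N) g \<in> H_carrier"
    using N assms by (intro integral_in_carrier) (auto simp: gscale_def vecs_scale)
  then have "gscale (of_nat m) g \<in> H_carrier" if "N dvd m" for m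
  proof -
    obtain k where "m = N * k" using \<open>N dvd m\<close> by (elim dvdE)
    then have "gscale (of_nat m) g = gscale (of_int (int k)) (gscale (of_nat N) g)"
      by (simp add: mult.commute)
    then show ?thesis using gscale_int_carrier[OF \<open>gscale (of_nat N) g \<in> H_carrier\<close>, of "int k"] by (simp only:)
  qed
  with N(1) show thesis using that by blast
qed

text \<open>The scalar is kept apart from the vector so that scaling an embedded vector changes
  \<open>c\<close> alone.\<close>

definition inl :: "rat \<Rightarrow> ('i \<Rightarrow> rat) \<Rightarrow> ('i \<Rightarrow> rat) \<times> ('i \<Rightarrow> rat)" where
  "inl c v = (\<lambda>t. c * v t, \<lambda>t. 0)"

definition inr :: "rat \<Rightarrow> ('i \<Rightarrow> rat) \<Rightarrow> ('i \<Rightarrow> rat) \<times> ('i \<Rightarrow> rat)" where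
  "inr c v = (\<lambda>t. 0, \<lambda>t. c * v t)"

lemma inl_simps [simp]:
  "fst (inl c v) = (\<lambda>t. c * v t)" "snd (inl c v) = (\<lambda>t. 0)" "gscale d (inl c v) = inl (d * c) v"
  by (simp_all add: gscale_def inl_def mult.assoc)

lemma inr_simps [simp]:
  "snd (inr c v) = (\<lambda>t. c * v t)" "fst (inr c v) = (\<lambda>t. 0)" "gscale d (inr c v) = inr (d * c) v"
  by (simp_all add: gscale_def inr_def mult.assoc)

lemma gadd_inl_inr: "gadd (inl c v) (inr d w) = (\<lambda>t. c * v t, \<lambda>t. d * w t)"
  by (simp add: gadd_def)

lemma comm_group_hopf_group: "comm_group hopf_group"
proof (rule comm_groupI)
  show "\<one>\<^bsub>hopf_group\<^esub> \<in> H_carrier"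
    by (rule integral_in_carrier) (simp_all add: vecs_zero)
  show "\<exists>h\<in>H_carrier. h \<otimes>\<^bsub>hopf_group\<^esub> g = \<one>\<^bsub>hopf_group\<^esub>" if "g \<in> H_carrier" for g
    by (rule bexI[OF _ gscale_int_carrier[OF that, of "-1"]]) (simp add: gadd_def gscale_def)
qed (simp_all add: gadd_carrier, simp_all add: gadd_def algebra_simps)

lemma torsion_free_hopf_group: "torsion_free hopf_group"
proof -
  interpret comm_group hopf_group by (rule comm_group_hopf_group)
  have pow: "g [^]\<^bsub>hopf_group\<^esub> (n::nat) = gscale (of_nat n) g" for g n
    by (induction n) (simp_all add: gscale_def gadd_def algebra_simps)
  show ?thesis
    unfolding torsion_free_def pow by (auto simp: gscale_def prod_eq_iff fun_eq_iff)
qed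

text \<open>By linearity every defect is divided by \<open>p ^ k\<close>: the one at
  \<open>p\<close> is zero, and those at the other primes stay integral there.\<close>

lemma divide_in_carrier:
  assumes p: "p \<in> labels" and g: "g \<in> H_carrier" "\<And>t. defect p g t = 0"
  shows "gscale (1 / of_nat p ^ k) g \<in> H_carrier"
  unfolding in_carrier_iff
proof (intro conjI ballI allI)
  fix q :: nat and t assume q: "q \<in> labels"
  have d: "defect q (gscale (1 / of_nat p ^ k) g) t = defect q g t / of_nat p ^ k"
    using g by (simp add: defect_scale in_carrier_iff)
  show "p_integral q (defect q (gscale (1 / of_nat p ^ k) g) t)"
  proof (cases "q = p")
    case True
    then show ?thesis unfolding d using g(2) p_integral_Ints[OF primes[OF p]] by simp
  next
    case False
    then show ?thesis
      unfolding d using p_integral_divide primes p q g(1) unfolding in_carrier_iff by blast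
  qed
qed (use g in \<open>auto simp: in_carrier_iff intro: gscale_vecs\<close>)

end

section \<open>From a system on the group to a system on the rational space\<close>

locale hopf_system = indexed_pairing + extension_system hopf_group \<F> for \<F>
begin

text \<open>Positive multiples are iterated sums and hence known at the same stage; the zero
  multiple is not such a sum.\<close>

lemma mult_nat:
  assumes "F \<in> \<F>" "(g, h) \<in> F" "n > 0"
  shows "(gscale (of_nat n) g, gscale (of_nat n) h) \<in> F"
  using assms(3)
proof (induction n rule: nat_induct_non_zero)
  case 1
  show ?case using assms by simp
next
  case (Suc n)
  have "(gadd (gscale 1 g) (gscale (of_nat n) g), gadd (gscale 1 h) (gscale (of_nat n) h)) \<in> F"
    using mult[OF assms(1,2) Suc.IH] by simp
  then show ?case unfolding gscale_add_left by simp
qed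

text \<open>Extending the domain supplies some image \<open>k\<close> of the multiple. Adding
  \<open>m = 1 + |a|\<close> copies of \<open>g\<close> makes the total multiple \<open>l\<close>
  positive, and there \<open>mult_nat\<close> and uniqueness identify \<open>k\<close>.\<close>

lemma mult_int:
  assumes F: "F \<in> \<F>" "(g, h) \<in> F"
  shows "\<exists>F'\<in>\<F>. F \<subseteq> F' \<and> (gscale (of_int a) g, gscale (of_int a) h) \<in> F'"
proof -
  obtain F' k where F': "F' \<in> \<F>" "F \<subseteq> F'" "(gscale (of_int a) g, k) \<in> F'"
    using extend_dom[OF F(1) gscale_int_carrier[OF dom[OF F]]] by blast
  define m where "m = nat (1 + \<bar>a\<bar>)"
  define l where "l = nat (1 + \<bar>a\<bar> + a)"
  have l: "(of_nat l :: rat) = of_nat m + of_int a" "m > 0" "l > 0"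
    by (auto simp: l_def m_def)
  have gh: "(g, h) \<in> F'" using F F' by blast
  have "(gadd (gscale (of_nat m) g) (gscale (of_int a) g), gadd (gscale (of_nat m) h) k) \<in> F'"
    using mult[OF F'(1) mult_nat[OF F'(1) gh l(2)] F'(3)] by simp
  then have "(gscale (of_nat l) g, gadd (gscale (of_nat m) h) k) \<in> F'"
    unfolding gscale_add_left l(1) .
  then have "gadd (gscale (of_nat m) h) k = gscale (of_nat l) h"
    using unique[OF F'(1)] mult_nat[OF F'(1) gh l(3)] by blast
  then have "k = gscale (of_int a) h"
    by (auto simp: l(1) gadd_def gscale_def prod_eq_iff fun_eq_iff algebra_simps)
  then show ?thesis using F' by blast
qed

text \<open>Each quotient of \<open>g\<close> by \<open>p ^ k\<close> acquires an image at a later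
  stage, and \<open>p ^ k\<close> times that image must be \<open>h\<close>. So the entries of the
  defect of \<open>h\<close> are infinitely \<open>p\<close>-divisible in the localization and
  therefore vanish.\<close>

lemma defect_preserved:
  assumes F: "F \<in> \<F>" "(g, h) \<in> F" and p: "p \<in> labels" and g: "\<And>t. defect p g t = 0"
  shows "defect p h t = 0"
proof (rule p_integral_all_powers)
  show "prime p" using primes p .
  fix k
  have pk: "(of_nat (p ^ k) :: rat) \<noteq> 0" "p ^ k > 0" using primes[OF p] by (auto simp: prime_gt_0_nat)
  obtain F' h' where F': "F' \<in> \<F>" "F \<subseteq> F'" "(gscale (1 / of_nat p ^ k) g, h') \<in> F'"
    using extend_dom[OF F(1) divide_in_carrier[OF p dom[OF F] g]] by blast
  have one: "of_nat (p ^ k) * (1 / of_nat p ^ k) = (1::rat)" using pk(1) by simp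
  have "(g, gscale (of_nat (p ^ k)) h') \<in> F'"
    using mult_nat[OF F'(1,3) pk(2)] by (simp only: gscale_gscale one gscale_one)
  then have h: "h = gscale (of_nat (p ^ k)) h'" using unique[OF F'(1)] F(2) F'(2) by blast
  have h': "h' \<in> H_carrier" using ran[OF F'(1,3)] .
  then have "defect p h t / of_nat p ^ k = defect p h' t"
    unfolding h using pk(1) by (simp add: defect_scale in_carrier_iff)
  then show "p_integral p (defect p h t / of_nat p ^ k)"
    using h' p unfolding in_carrier_iff by simp
qed

text \<open>The five kernels are read as the relations they encode: the two summands, the diagonal
  and the graphs of the operators, where 7 serves \<open>lst\<close> and 11 serves
  \<open>id\<close>.\<close>

lemma preserved:
  assumes F: "F \<in> \<F>" "(g, h) \<in> F"
  shows "snd g = (\<lambda>t. 0) \<Longrightarrow> snd h = (\<lambda>t. 0)"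
    and "fst g = (\<lambda>t. 0) \<Longrightarrow> fst h = (\<lambda>t. 0)"
    and "fst g = snd g \<Longrightarrow> fst h = snd h"
    and "\<rho> \<in> {id, lst} \<Longrightarrow> push \<rho> (fst g) = snd g \<Longrightarrow> push \<rho> (fst h) = snd h"
proof -
  note d = defect_preserved[OF F]
  show "snd g = (\<lambda>t. 0) \<Longrightarrow> snd h = (\<lambda>t. 0)"
    using d[of 2] by (simp add: labels_def defect_def fun_eq_iff)
  show "fst g = (\<lambda>t. 0) \<Longrightarrow> fst h = (\<lambda>t. 0)"
    using d[of 3] by (simp add: labels_def defect_def fun_eq_iff)
  show "fst g = snd g \<Longrightarrow> fst h = snd h"
    using d[of 5] by (simp add: labels_def defect_def fun_eq_iff)
  show "push \<rho> (fst h) = snd h" if "\<rho> \<in> {id, lst}" "push \<rho> (fst g) = snd g"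
  proof
    show "push \<rho> (fst h) t = snd h t" for t
      using d[of 7 t] d[of 11 t] that by (auto simp: labels_def defect_def)
  qed
qed

text \<open>A rational vector need not lie in the first summand of the group, but a positive
  multiple does; the partial linear map is read off from such multiples.\<close>

definition lift :: "(('a \<Rightarrow> rat) \<times> ('a \<Rightarrow> rat)) rel \<Rightarrow> ('a \<Rightarrow> rat) rel" where
  "lift F = {(v, v') \<in> vecs \<times> vecs. \<exists>n::nat. n > 0 \<and> (inl (of_nat n) v, inl (of_nat n) v') \<in> F}"

lemma liftI:
  "v \<in> vecs \<Longrightarrow> v' \<in> vecs \<Longrightarrow> n > 0 \<Longrightarrow> (inl (of_nat n) v, inl (of_nat n) v') \<in> F \<Longrightarrow> (v, v') \<in> lift F"
  unfolding lift_def by blast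

lemma lift_mono: "F \<subseteq> F' \<Longrightarrow> lift F \<subseteq> lift F'"
  unfolding lift_def by blast

text \<open>Having all multiples of the witness allows two vectors to be treated with one common
  multiplier.\<close>

lemma liftE:
  assumes "(v, v') \<in> lift F" "F \<in> \<F>"
  obtains n :: nat where "n > 0" "v \<in> vecs" "v' \<in> vecs"
    "\<And>m. n dvd m \<Longrightarrow> m > 0 \<Longrightarrow> (inl (of_nat m) v, inl (of_nat m) v') \<in> F"
proof -
  obtain n :: nat where n: "n > 0" "v \<in> vecs" "v' \<in> vecs" "(inl (of_nat n) v, inl (of_nat n) v') \<in> F"
    using assms unfolding lift_def by blast
  have "(inl (of_nat m) v, inl (of_nat m) v') \<in> F" if "n dvd m" "m > 0" for m
  proof -
    obtain k where "m = n * k" using \<open>n dvd m\<close> by (elim dvdE)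
    then show ?thesis
      using mult_nat[OF assms(2) n(4), of k] \<open>m > 0\<close> by (simp add: mult.commute)
  qed
  with n show thesis using that by blast
qed

lemma inl_image:
  assumes F: "F \<in> \<F>" "(inl c v, h) \<in> F"
  shows "h = inl 1 (fst h)" "fst h \<in> vecs"
  using preserved(1)[OF F] ran[OF F] by (simp_all add: prod_eq_iff in_carrier_iff)

lemma inr_image:
  assumes F: "F \<in> \<F>" "(inr c v, h) \<in> F"
  shows "h = inr 1 (snd h)" "snd h \<in> vecs"
  using preserved(2)[OF F] ran[OF F] by (simp_all add: prod_eq_iff in_carrier_iff)

text \<open>Both vectors are scaled by the same \<open>m\<close>, a multiple of a prescribed
  \<open>k\<close>, so that multipliers fixed earlier remain usable. The images stay in their
  summands because the summands are preserved.\<close>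

lemma extend_inl_inr:
  assumes F: "F \<in> \<F>" and u: "u \<in> vecs" "w \<in> vecs" and k: "k > (0::nat)"
  obtains F' and m :: nat and a b where "F' \<in> \<F>" "F \<subseteq> F'" "m > 0" "k dvd m" "a \<in> vecs" "b \<in> vecs"
    "(inl (of_nat m) u, inl 1 a) \<in> F'" "(inr (of_nat m) w, inr 1 b) \<in> F'"
proof -
  obtain N where N: "N > 0" "\<And>m. N dvd m \<Longrightarrow> gscale (of_nat m) (inl 1 u) \<in> H_carrier"
    by (rule multiple_in_carrier[of "inl 1 u"]) (use u vecs_zero in auto)
  obtain M where M: "M > 0" "\<And>m. M dvd m \<Longrightarrow> gscale (of_nat m) (inr 1 w) \<in> H_carrier"
    by (rule multiple_in_carrier[of "inr 1 w"]) (use u vecs_zero in auto)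
  define m where "m = k * N * M"
  have m: "m > 0" "k dvd m" "N dvd m" "M dvd m" using k N M by (auto simp: m_def)
  have c: "inl (of_nat m) u \<in> H_carrier" "inr (of_nat m) w \<in> H_carrier"
    using N(2)[OF m(3)] M(2)[OF m(4)] by simp_all
  obtain F1 a where F1: "F1 \<in> \<F>" "F \<subseteq> F1" "(inl (of_nat m) u, a) \<in> F1"
    using extend_dom[OF F c(1)] by blast
  obtain F2 b where F2: "F2 \<in> \<F>" "F1 \<subseteq> F2" "(inr (of_nat m) w, b) \<in> F2"
    using extend_dom[OF F1(1) c(2)] by blast
  have ab: "(inl (of_nat m) u, inl 1 (fst a)) \<in> F2" "(inr (of_nat m) w, inr 1 (snd b)) \<in> F2"
    using inl_image(1)[OF F1(1,3)] inr_image(1)[OF F2(1,3)] F1(3) F2(2,3) by auto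
  show thesis
    by (rule that[OF F2(1) _ m(1,2) inl_image(2)[OF F1(1,3)] inr_image(2)[OF F2(1,3)] ab])
      (use F1 F2 in blast)
qed

text \<open>The second summand is an intermediate station: the graph of \<open>push \<rho>\<close>
  determines the image of a multiple of \<open>push \<rho> v\<close> placed there, and the diagonal
  carries the result back to the first summand.\<close>

lemma lift_push:
  assumes F: "F \<in> \<F>" "(v, v') \<in> lift F" and \<rho>: "\<rho> \<in> {id, lst}"
  shows "\<exists>F'\<in>\<F>. F \<subseteq> F' \<and> (push \<rho> v, push \<rho> v') \<in> lift F'"
proof -
  obtain n where n: "n > 0" and v: "v \<in> vecs" "v' \<in> vecs"
    and nF: "\<And>m. n dvd m \<Longrightarrow> m > 0 \<Longrightarrow> (inl (of_nat m) v, inl (of_nat m) v') \<in> F"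
    using liftE[OF F(2,1)] by blast
  let ?u = "push \<rho> v"
  have u: "?u \<in> vecs" using vecs_push v by blast
  obtain F' m a b where F': "F' \<in> \<F>" "F \<subseteq> F'" and m: "m > 0" "n dvd m"
    and a: "(inl (of_nat m) ?u, inl 1 a) \<in> F'" and b: "(inr (of_nat m) ?u, inr 1 b) \<in> F'"
    by (rule extend_inl_inr[OF F(1) u u n])
  \<comment> \<open>The sum is \<open>m\<close> times the point of the graph of
    \<open>push \<rho>\<close> over \<open>v\<close>.\<close>
  have "(gadd (inl (of_nat m) v) (inr (of_nat m) ?u), gadd (inl (of_nat m) v') (inr 1 b)) \<in> F'"
    using mult[OF F'(1) subsetD[OF F'(2) nF[OF m(2,1)]] b] by simp
  from preserved(4)[OF F'(1) this \<rho>] have "push \<rho> (\<lambda>t. of_nat m * v' t) = b"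
    using push_scale[OF v(1)] by (simp add: gadd_inl_inr fun_eq_iff)
  then have b': "b = (\<lambda>t. of_nat m * push \<rho> v' t)" using push_scale[OF v(2)] by (auto simp: fun_eq_iff)
  \<comment> \<open>A diagonal element: both summands are acted on in the same way.\<close>
  have "(gadd (inl (of_nat m) ?u) (inr (of_nat m) ?u), gadd (inl 1 a) (inr 1 b)) \<in> F'"
    using mult[OF F'(1) a b] by simp
  from preserved(3)[OF F'(1) this] have "a = b" by (simp add: gadd_inl_inr)
  then have "inl 1 a = inl (of_nat m) (push \<rho> v')" using b' by (simp add: inl_def)
  then have "(?u, push \<rho> v') \<in> lift F'"
    using liftI[OF u vecs_push[OF v(2)] m(1)] a by simp
  then show ?thesis using F' by blast
qed

lemma lift_extend_dom:
  assumes F: "F \<in> \<F>" and v: "v \<in> vecs"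
  shows "\<exists>F'\<in>\<F>. F \<subseteq> F' \<and> (\<exists>v'. (v, v') \<in> lift F')"
proof -
  obtain F' m v' where F': "F' \<in> \<F>" "F \<subseteq> F'" and m: "m > (0::nat)" and v': "v' \<in> vecs"
      "(inl (of_nat m) v, inl 1 v') \<in> F'"
    by (rule extend_inl_inr[OF F v v zero_less_one])
  have "inl 1 v' = inl (of_nat m) (\<lambda>t. v' t / of_nat m)" using m by (simp add: inl_def)
  moreover have "(\<lambda>t. v' t / of_nat m) \<in> vecs" using vecs_scale[OF v'(1), of "1 / of_nat m"] by simp
  ultimately have "(v, \<lambda>t. v' t / of_nat m) \<in> lift F'"
    using m v v' by (intro liftI[of _ _ m]) auto
  then show ?thesis using F' by blast
qed

text \<open>An image in the first summand may come from an element with a nonzero second component.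
  Splitting a multiple of \<open>g\<close> shows that the second component is then sent to zero on
  its own.\<close>

lemma decompose:
  assumes F: "F \<in> \<F>" "(g, inl c v) \<in> F"
  obtains F' and m :: nat where "F' \<in> \<F>" "F \<subseteq> F'" "m > 0"
    "(inl (of_nat m) (fst g), inl (of_nat m * c) v) \<in> F'" "(inr (of_nat m) (snd g), (\<lambda>t. 0, \<lambda>t. 0)) \<in> F'"
proof -
  have g: "fst g \<in> vecs" "snd g \<in> vecs" using dom[OF F] by (auto simp: in_carrier_iff)
  obtain F' m a b where F': "F' \<in> \<F>" "F \<subseteq> F'" and m: "m > (0::nat)"
    and a: "(inl (of_nat m) (fst g), inl 1 a) \<in> F'" and b: "(inr (of_nat m) (snd g), inr 1 b) \<in> F'"
    by (rule extend_inl_inr[OF F(1) g zero_less_one])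
  have "gadd (inl (of_nat m) (fst g)) (inr (of_nat m) (snd g)) = gscale (of_nat m) g"
    by (simp add: gadd_inl_inr gscale_def)
  then have "(gscale (of_nat m) g, gadd (inl 1 a) (inr 1 b)) \<in> F'" using mult[OF F'(1) a b] by simp
  moreover have "(gscale (of_nat m) g, inl (of_nat m * c) v) \<in> F'"
    using mult_nat[OF F'(1) subsetD[OF F'(2) F(2)] m] by simp
  ultimately have "gadd (inl 1 a) (inr 1 b) = inl (of_nat m * c) v" using unique[OF F'(1)] by blast
  then have "inl 1 a = inl (of_nat m * c) v" "inr 1 b = (\<lambda>t. 0, \<lambda>t. 0)"
    unfolding gadd_inl_inr by (simp_all add: inl_def inr_def)
  then show thesis using that[OF F' m] a b by simp
qed

text \<open>A preimage of a multiple of \<open>v'\<close> in the group may leave the first summand;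
  by \<open>decompose\<close> its first component already has the required image.\<close>

lemma lift_extend_ran:
  assumes F: "F \<in> \<F>" and v': "v' \<in> vecs"
  shows "\<exists>F'\<in>\<F>. F \<subseteq> F' \<and> (\<exists>v. (v, v') \<in> lift F')"
proof -
  obtain n where n: "n > 0" "\<And>m. n dvd m \<Longrightarrow> gscale (of_nat m) (inl 1 v') \<in> H_carrier"
    by (rule multiple_in_carrier[of "inl 1 v'"]) (use v' vecs_zero in auto)
  then have "inl (of_nat n) v' \<in> H_carrier" using n(2)[of n] by simp
  then obtain F1 g where F1: "F1 \<in> \<F>" "F \<subseteq> F1" "(g, inl (of_nat n) v') \<in> F1"
    using extend_ran[OF F] by blast
  obtain F2 m where F2: "F2 \<in> \<F>" "F1 \<subseteq> F2" and m: "m > (0::nat)"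
    "(inl (of_nat m) (fst g), inl (of_nat m * of_nat n) v') \<in> F2"
    by (rule decompose[OF F1(1,3)])
  have g: "fst g \<in> vecs" using dom[OF F1(1,3)] by (auto simp: in_carrier_iff)
  have "inl (of_nat m) (fst g) = inl (of_nat (m * n)) (\<lambda>t. fst g t / of_nat n)"
    using n(1) by (simp add: inl_def)
  moreover have "(\<lambda>t. fst g t / of_nat n) \<in> vecs" using vecs_scale[OF g, of "1 / of_nat n"] by simp
  ultimately have "((\<lambda>t. fst g t / of_nat n), v') \<in> lift F2"
    using m n(1) v' by (intro liftI[of _ _ "m * n"]) auto
  then show ?thesis using F1 F2 by blast
qed

sublocale lifted: vec_system W lt code par lst "lift ` \<F>"
proof
  fix E assume "E \<in> lift ` \<F>"
  then obtain F where F: "F \<in> \<F>" "E = lift F" by blast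
  \<comment> \<open>Monotonicity of \<open>lift\<close> turns later stages on the group into later
    stages on vectors.\<close>
  have ext: "\<exists>E'\<in>lift ` \<F>. E \<subseteq> E' \<and> X \<in> E'" if "F' \<in> \<F>" "F \<subseteq> F'" "X \<in> lift F'" for F' X
    using lift_mono[OF that(2)] that(1,3) unfolding F(2) by blast
  show "(v, v') \<in> E \<Longrightarrow> v \<in> vecs" "(v, v') \<in> E \<Longrightarrow> v' \<in> vecs" for v v'
    by (auto simp: F lift_def)
  show "v' = v''" if v: "(v, v') \<in> E" "(v, v'') \<in> E" for v v' v''
  proof -
    obtain n where n: "n > 0" "v \<in> vecs" "v' \<in> vecs"
      "\<And>m. n dvd m \<Longrightarrow> m > 0 \<Longrightarrow> (inl (of_nat m) v, inl (of_nat m) v') \<in> F"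
      using liftE[OF v(1)[unfolded F(2)] F(1)] by blast
    obtain k where k: "k > 0" "v \<in> vecs" "v'' \<in> vecs"
      "\<And>m. k dvd m \<Longrightarrow> m > 0 \<Longrightarrow> (inl (of_nat m) v, inl (of_nat m) v'') \<in> F"
      using liftE[OF v(2)[unfolded F(2)] F(1)] by blast
    have "inl (of_nat (n * k)) v' = inl (of_nat (n * k)) v''"
      using unique[OF F(1) n(4)[of "n * k"] k(4)[of "n * k"]] n(1) k(1) by simp
    then show ?thesis using n(1) k(1) by (simp add: inl_def fun_eq_iff)
  qed
  show "((\<lambda>t. v t + w t), (\<lambda>t. v' t + w' t)) \<in> E" if vw: "(v, v') \<in> E" "(w, w') \<in> E" for v v' w w'
  proof -
    obtain n where n: "n > 0" "v \<in> vecs" "v' \<in> vecs"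
      "\<And>m. n dvd m \<Longrightarrow> m > 0 \<Longrightarrow> (inl (of_nat m) v, inl (of_nat m) v') \<in> F"
      using liftE[OF vw(1)[unfolded F(2)] F(1)] by blast
    obtain k where k: "k > 0" "w \<in> vecs" "w' \<in> vecs"
      "\<And>m. k dvd m \<Longrightarrow> m > 0 \<Longrightarrow> (inl (of_nat m) w, inl (of_nat m) w') \<in> F"
      using liftE[OF vw(2)[unfolded F(2)] F(1)] by blast
    have "(inl (of_nat (n * k)) (\<lambda>t. v t + w t), inl (of_nat (n * k)) (\<lambda>t. v' t + w' t)) \<in> F"
      using mult[OF F(1) n(4)[of "n * k"] k(4)[of "n * k"]] n(1) k(1)
      by (simp add: gadd_def inl_def algebra_simps)
    then show ?thesis unfolding F using n k vecs_add by (intro liftI[of _ _ "n * k"]) auto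
  qed
  show "\<exists>E'\<in>lift ` \<F>. E \<subseteq> E' \<and> ((\<lambda>t. c * v t), (\<lambda>t. c * v' t)) \<in> E'" if v: "(v, v') \<in> E" for v v' c
  proof -
    obtain n where n: "n > 0" "v \<in> vecs" "v' \<in> vecs" "(inl (of_nat n) v, inl (of_nat n) v') \<in> F"
      using v unfolding F(2) lift_def by blast
    obtain a d where ad: "c = of_int a / of_int d" "d > 0"
      by (metis quotient_of_denom_pos quotient_of_div surj_pair)
    obtain F' where F': "F' \<in> \<F>" "F \<subseteq> F'"
      "(gscale (of_int a) (inl (of_nat n) v), gscale (of_int a) (inl (of_nat n) v')) \<in> F'"
      using mult_int[OF F(1) n(4), of a] by blast
    \<comment> \<open>The denominator \<open>d\<close> of the scalar is absorbed into the multiplier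
      allowed by \<open>lift\<close>.\<close>
    have "gscale (of_int a) (inl (of_nat n) x) = inl (of_nat (n * nat d)) (\<lambda>t. c * x t)" for x
      using ad by (simp add: gscale_def inl_def mult.left_commute)
    then have "((\<lambda>t. c * v t), (\<lambda>t. c * v' t)) \<in> lift F'"
      using F'(3) n(1) ad(2) by (intro liftI[of _ _ "n * nat d"] vecs_scale n(2,3)) auto
    then show ?thesis using ext F' by blast
  qed
  show "\<exists>E'\<in>lift ` \<F>. E \<subseteq> E' \<and> (push \<rho> v, push \<rho> v') \<in> E'"
    if v: "(v, v') \<in> E" "\<rho> \<in> {id, lst}" for v v' \<rho>
  proof -
    have "(v, v') \<in> lift F" using v(1) F(2) by simp
    from lift_push[OF F(1) this v(2)] show ?thesis using ext by blast
  qed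
  show "\<exists>E'\<in>lift ` \<F>. E \<subseteq> E' \<and> (\<exists>v'. (v, v') \<in> E')" if v: "v \<in> vecs" for v
  proof -
    obtain F' v' where F': "F' \<in> \<F>" "F \<subseteq> F'" "(v, v') \<in> lift F'"
      using lift_extend_dom[OF F(1) v] by blast
    show ?thesis using ext[OF F'] by blast
  qed
  show "\<exists>E'\<in>lift ` \<F>. E \<subseteq> E' \<and> (\<exists>v. (v, v') \<in> E')" if v: "v' \<in> vecs" for v'
  proof -
    obtain F' v where F': "F' \<in> \<F>" "F \<subseteq> F'" "(v, v') \<in> lift F'"
      using lift_extend_ran[OF F(1) v] by blast
    show ?thesis using ext[OF F'] by blast
  qed
qed

lemma inl_kernel:
  assumes F: "F \<in> \<F>" and v: "v \<in> vecs" "(inl (of_nat n) v, (\<lambda>t. 0, \<lambda>t. 0)) \<in> F" "n > 0"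
  shows "v = (\<lambda>t. 0)"
proof -
  have "(v, \<lambda>t. 0) \<in> lift F"
    using v vecs_zero by (intro liftI[of _ _ n]) (auto simp: inl_def)
  then show ?thesis using lifted.vec_system_kernel[of "lift F"] F by blast
qed

text \<open>Multiples of both components of \<open>g\<close> are sent to zero. The first component
  is settled by the lifted system; the second is moved to the first summand along the diagonal and
  settled in the same way.\<close>

lemma kernel:
  assumes F: "F \<in> \<F>" "(g, (\<lambda>t. 0, \<lambda>t. 0)) \<in> F"
  shows "g = (\<lambda>t. 0, \<lambda>t. 0)"
proof -
  have g: "fst g \<in> vecs" "snd g \<in> vecs" using dom[OF F] by (auto simp: in_carrier_iff)
  have "(g, inl 1 (\<lambda>t. 0)) \<in> F" using F(2) by (simp add: inl_def)
  from decompose[OF F(1) this] obtain F1 m where F1: "F1 \<in> \<F>" "F \<subseteq> F1" and m: "m > (0::nat)"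
    and l: "(inl (of_nat m) (fst g), (\<lambda>t. 0, \<lambda>t. 0)) \<in> F1"
    and r: "(inr (of_nat m) (snd g), (\<lambda>t. 0, \<lambda>t. 0)) \<in> F1"
    by (auto simp: inl_def)
  obtain F2 n c where F2: "F2 \<in> \<F>" "F1 \<subseteq> F2" and n: "n > 0" "m dvd n"
    and c: "(inl (of_nat n) (snd g), inl 1 c) \<in> F2"
    by (rule extend_inl_inr[OF F1(1) g(2,2) m])
  obtain k where k: "n = m * k" using n(2) by (elim dvdE)
  then have "k > 0" using n(1) by simp
  have "(inr (of_nat n) (snd g), inr 1 (\<lambda>t. 0)) \<in> F2"
    using mult_nat[OF F2(1) subsetD[OF F2(2) r] \<open>k > 0\<close>] by (simp add: k mult.commute) (simp add: gscale_def inr_def)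
  then have "(gadd (inl (of_nat n) (snd g)) (inr (of_nat n) (snd g)), gadd (inl 1 c) (inr 1 (\<lambda>t. 0))) \<in> F2"
    using mult[OF F2(1) c] by simp
  from preserved(3)[OF F2(1) this] have "c = (\<lambda>t. 0)" by (simp add: gadd_inl_inr)
  then have "inl 1 c = (\<lambda>t. 0, \<lambda>t. 0)" by (simp add: inl_def)
  then have "fst g = (\<lambda>t. 0)" "snd g = (\<lambda>t. 0)"
    using inl_kernel[OF F1(1) g(1) l m] inl_kernel[OF F2(1) g(2) _ n(1)] c by simp_all
  then show ?thesis by (simp add: prod_eq_iff)
qed

lemma injective:
  assumes F: "F \<in> \<F>" "(g, k) \<in> F" "(h, k) \<in> F"
  shows "g = h"
proof -
  \<comment> \<open>The negative of \<open>h\<close> may acquire its image only later, so the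
    difference is formed at an extension of \<open>F\<close>.\<close>
  obtain F' where F': "F' \<in> \<F>" "F \<subseteq> F'" "(gscale (of_int (-1)) h, gscale (of_int (-1)) k) \<in> F'"
    using mult_int[OF F(1,3), of "-1"] by blast
  have "(gadd g (gscale (-1) h), gadd k (gscale (-1) k)) \<in> F'"
    using mult[OF F'(1) _ F'(3), of g k] F(2) F'(2) by auto
  then have "(gadd g (gscale (-1) h), (\<lambda>t. 0, \<lambda>t. 0)) \<in> F'"
    by (simp add: gadd_def gscale_def)
  from kernel[OF F'(1) this] show ?thesis
    by (auto simp: gadd_def gscale_def prod_eq_iff fun_eq_iff)
qed

end

lemma (in indexed_pairing) persistently_hopfian_hopf_group: "persistently_hopfian hopf_group"
  unfolding persistently_hopfian_def
proof (intro allI impI ballI)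
  fix \<F> F
  assume sys: "extension_system hopf_group \<F>" and F: "F \<in> \<F>"
  interpret extension_system hopf_group \<F> by (rule sys)
  interpret hopf_system W lt code par lst \<F> ..
  show "single_valued (F\<inverse>)"
    using injective[OF F] by (auto simp: single_valued_def)
qed

section \<open>The forcing relation\<close>

locale forcing =
  fixes Q R :: "'v::zfc_universe"
  assumes forcing: "forcing_notion Q R"
begin

abbreviation below :: "'v \<Rightarrow> 'v set" where "below p \<equiv> extensions Q R p"
abbreviation feq :: "'v \<Rightarrow> 'v \<Rightarrow> 'v \<Rightarrow> bool" where "feq \<equiv> forces_eq Q R"
abbreviation fmem :: "'v \<Rightarrow> 'v \<Rightarrow> 'v \<Rightarrow> bool" where "fmem \<equiv> forces_mem Q R"
abbreviation name :: "'v \<Rightarrow> bool" where "name \<equiv> is_name Q"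
abbreviation force :: "fm \<Rightarrow> 'v \<Rightarrow> (nat \<Rightarrow> 'v) \<Rightarrow> bool" where "force \<equiv> forces Q R"

lemma below_Q [dest]: "q \<in> below p \<Longrightarrow> q \<in> elts Q"
  by (simp add: extensions_def)

lemma below_refl [simp]: "p \<in> elts Q \<Longrightarrow> p \<in> below p"
  using forcing by (simp add: extensions_def forcing_notion_def)

lemma below_trans: "r \<in> below q \<Longrightarrow> q \<in> below p \<Longrightarrow> p \<in> elts Q \<Longrightarrow> r \<in> below p"
  using forcing unfolding extensions_def forcing_notion_def by blast

lemma name_elem:
  assumes "name x" "vpair z s \<in> elts x"
  shows "name z" "s \<in> elts Q"
proof -
  obtain y p where "name y" "p \<in> elts Q" "vpair z s = vpair y p"
    using assms by (cases rule: is_name.cases) blast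
  then show "name z" "s \<in> elts Q" by (simp_all del: elts_vpair)
qed

section \<open>Forced equality as an equivalence respected by forced membership\<close>

lemma feq_refl: "name x \<Longrightarrow> p \<in> elts Q \<Longrightarrow> feq p x x"
proof (induction arbitrary: p rule: is_name.induct)
  case (1 x)
  have *: "s \<in> elts Q \<and> (\<forall>p\<in>elts Q. feq p z z)" if "vpair z s \<in> elts x" for z s
    using 1(1)[OF that] by (auto simp del: elts_vpair)
  show ?case
    by (rule forces_eq.intros) (use * below_Q below_refl in blast)+
qed

lemma feq_sym: "feq p x y \<Longrightarrow> feq p y x"
proof (induction rule: forces_eq.induct)
  case (1 x p y)
  show ?case by (rule forces_eq.intros) (use 1 in blast)+
qed

lemma feqD1:
  "feq p x y \<Longrightarrow> vpair z s \<in> elts x \<Longrightarrow> q \<in> below p \<Longrightarrow> q \<in> below s \<Longrightarrow>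
   \<exists>r\<in>below q. \<exists>w t. vpair w t \<in> elts y \<and> r \<in> below t \<and> feq r z w"
  by (erule forces_eq.cases) blast

lemma feqD2:
  "feq p x y \<Longrightarrow> vpair w t \<in> elts y \<Longrightarrow> q \<in> below p \<Longrightarrow> q \<in> below t \<Longrightarrow>
   \<exists>r\<in>below q. \<exists>z s. vpair z s \<in> elts x \<and> r \<in> below s \<and> feq r z w"
  by (erule forces_eq.cases) blast

lemma feq_mono: "feq p x y \<Longrightarrow> q \<in> below p \<Longrightarrow> p \<in> elts Q \<Longrightarrow> feq q x y"
  by (rule forces_eq.intros) (meson feqD1 feqD2 below_trans)+

text \<open>Induction on the first name with the other two arbitrary. A member of one outer name is
  followed through \<open>y\<close> to the other, and each passage strengthens the
  condition.\<close>

lemma feq_trans: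
  "name x \<Longrightarrow> name y \<Longrightarrow> name z \<Longrightarrow> p \<in> elts Q \<Longrightarrow> feq p x y \<Longrightarrow> feq p y z \<Longrightarrow> feq p x z"
proof (induction arbitrary: p y z rule: is_name.induct)
  case (1 x)
  have IH: "s \<in> elts Q \<and> (\<forall>y z p. name y \<longrightarrow> name z \<longrightarrow> p \<in> elts Q \<longrightarrow> feq p a y \<longrightarrow> feq p y z \<longrightarrow> feq p a z)"
    if "vpair a s \<in> elts x" for a s
    using 1(1)[OF that] by (elim exE conjE bexE) (simp only: vpair_eq, blast)
  show ?case
  proof (rule forces_eq.intros, goal_cases)
    case (1 a s q)
    obtain r b t where b: "r \<in> below q" "vpair b t \<in> elts y" "r \<in> below t" "feq r a b"
      using feqD1[OF \<open>feq p x y\<close> 1] by blast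
    have "r \<in> below p" using b 1 \<open>p \<in> elts Q\<close> below_trans by blast
    then obtain r' c u where c: "r' \<in> below r" "vpair c u \<in> elts z" "r' \<in> below u" "feq r' b c"
      using feqD1[OF \<open>feq p y z\<close> b(2) _ b(3)] by blast
    have "feq r' a b" using b c feq_mono by blast
    then have "feq r' a c"
      using IH[OF 1(1)] c name_elem[OF \<open>name y\<close> b(2)] name_elem[OF \<open>name z\<close> c(2)] by blast
    moreover have "r' \<in> below q" using b c 1 below_trans by blast
    ultimately show ?case using c by blast
  next
    case (2 c u q)
    obtain r b t where b: "r \<in> below q" "vpair b t \<in> elts y" "r \<in> below t" "feq r b c"
      using feqD2[OF \<open>feq p y z\<close> 2] by blast
    have "r \<in> below p" using b 2 \<open>p \<in> elts Q\<close> below_trans by blast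
    then obtain r' a s where a: "r' \<in> below r" "vpair a s \<in> elts x" "r' \<in> below s" "feq r' a b"
      using feqD2[OF \<open>feq p x y\<close> b(2) _ b(3)] by blast
    have "feq r' b c" using b a feq_mono by blast
    then have "feq r' a c"
      using IH[OF a(2)] a name_elem[OF \<open>name y\<close> b(2)] name_elem[OF \<open>name z\<close> 2(1)] by blast
    moreover have "r' \<in> below q" using b a 2 below_trans by blast
    ultimately show ?case using a by blast
  qed
qed

lemma fmem_mono: "fmem p x y \<Longrightarrow> q \<in> below p \<Longrightarrow> p \<in> elts Q \<Longrightarrow> fmem q x y"
  unfolding forces_mem_def by (meson below_trans)

text \<open>\<open>forces_mem\<close> is itself a density condition, so one more layer of density
  collapses into it.\<close>

lemma fmem_dense:
  assumes "\<And>q. q \<in> below p \<Longrightarrow> \<exists>r\<in>below q. fmem r x y"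
  shows "fmem p x y"
  unfolding forces_mem_def
proof
  fix q assume q: "q \<in> below p"
  then obtain r where r: "r \<in> below q" "fmem r x y" using assms by blast
  then have "r \<in> below r" by auto
  then obtain r' w t where "r' \<in> below r" "vpair w t \<in> elts y \<and> r' \<in> below t \<and> feq r' x w"
    using r(2) unfolding forces_mem_def by blast
  then show "\<exists>r\<in>below q. \<exists>w t. vpair w t \<in> elts y \<and> r \<in> below t \<and> feq r x w"
    using below_trans r q by blast
qed

lemma fmemE:
  assumes "fmem p x y" "p \<in> elts Q"
  obtains r w t where "r \<in> below p" "vpair w t \<in> elts y" "r \<in> below t" "feq r x w"
  using assms below_refl unfolding forces_mem_def by blast

lemma fmemI_elem:
  assumes "name y" "vpair x t \<in> elts y" "p \<in> below t"
  shows "fmem p x y"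
  unfolding forces_mem_def
proof
  fix q assume q: "q \<in> below p"
  then have "q \<in> below t" using below_trans assms name_elem(2) by blast
  moreover have "feq q x x" using q assms name_elem(1) feq_refl by blast
  ultimately show "\<exists>r\<in>below q. \<exists>w t. vpair w t \<in> elts y \<and> r \<in> below t \<and> feq r x w"
    using assms(2) q by (meson below_Q below_refl)
qed

lemma fmem_cong_left:
  assumes "fmem p x y" "feq p x x'" "name x" "name x'" "name y" "p \<in> elts Q"
  shows "fmem p x' y"
  unfolding forces_mem_def
proof
  fix q assume q: "q \<in> below p"
  then obtain r w t where r: "r \<in> below q" "vpair w t \<in> elts y" "r \<in> below t" "feq r x w"
    using assms(1) unfolding forces_mem_def by blast
  then have "feq r x' x" using feq_sym feq_mono assms q by (meson below_Q)
  then have "feq r x' w" using r assms name_elem feq_trans by (meson below_Q)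
  with r show "\<exists>r\<in>below q. \<exists>w t. vpair w t \<in> elts y \<and> r \<in> below t \<and> feq r x' w" by blast
qed

lemma fmem_cong_right:
  assumes "fmem p x y" "feq p y y'" "name x" "name y" "name y'" "p \<in> elts Q"
  shows "fmem p x y'"
  unfolding forces_mem_def
proof
  fix q assume q: "q \<in> below p"
  then obtain r w t where r: "r \<in> below q" "vpair w t \<in> elts y" "r \<in> below t" "feq r x w"
    using assms(1) unfolding forces_mem_def by blast
  have "r \<in> below p" using r q below_trans assms(6) by blast
  then obtain r' w' t' where r': "r' \<in> below r" "vpair w' t' \<in> elts y'" "r' \<in> below t'" "feq r' w w'"
    using feqD1[OF assms(2) r(2) _ r(3)] by blast
  have "feq r' x w" using r r' feq_mono by (meson below_Q)
  then have "feq r' x w'"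
    using r' assms feq_trans name_elem(1)[OF \<open>name y\<close> r(2)] name_elem(1)[OF \<open>name y'\<close> r'(2)]
    by (meson below_Q)
  with r r' q show "\<exists>r\<in>below q. \<exists>w t. vpair w t \<in> elts y' \<and> r \<in> below t \<and> feq r x w"
    using below_trans by (meson below_Q)
qed

text \<open>The recursive clauses speak of pairs occurring in a name; this version speaks of
  arbitrary names forced to be members, up to strengthening, which is what unfolded formulas
  supply.\<close>

lemma feq_ext:
  assumes "name x" "name y" "p \<in> elts Q"
    and "\<And>q w. q \<in> below p \<Longrightarrow> name w \<Longrightarrow> fmem q w x \<Longrightarrow> \<exists>r\<in>below q. fmem r w y"
    and "\<And>q w. q \<in> below p \<Longrightarrow> name w \<Longrightarrow> fmem q w y \<Longrightarrow> \<exists>r\<in>below q. fmem r w x"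
  shows "feq p x y"
proof -
  have *: "\<exists>r\<in>below q. \<exists>w t. vpair w t \<in> elts y \<and> r \<in> below t \<and> feq r z w"
    if h: "name x" "name y" "vpair z s \<in> elts x" "q \<in> below p" "q \<in> below s"
      "\<And>q w. q \<in> below p \<Longrightarrow> name w \<Longrightarrow> fmem q w x \<Longrightarrow> \<exists>r\<in>below q. fmem r w y" for x y z s q
  proof -
    have "fmem q z x" using fmemI_elem h by blast
    then obtain r where r: "r \<in> below q" "fmem r z y" using h(4) name_elem(1)[OF h(1,3)] h(6)[of q z] by blast
    have "r \<in> elts Q" using r by blast
    then obtain r' w t where "r' \<in> below r" "vpair w t \<in> elts y" "r' \<in> below t" "feq r' z w"
      using fmemE[OF r(2)] by blast
    moreover from this have "r' \<in> below q" using r h(4) below_trans below_Q by blast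
    ultimately show ?thesis by blast
  qed
  show ?thesis
  proof (rule forces_eq.intros)
    show "\<exists>r\<in>below q. \<exists>w t. vpair w t \<in> elts y \<and> r \<in> below t \<and> feq r z w"
      if "vpair z s \<in> elts x" "q \<in> below p" "q \<in> below s" for z s q
      by (rule *[OF assms(1,2) that assms(4)])
    show "\<exists>r\<in>below q. \<exists>z s. vpair z s \<in> elts x \<and> r \<in> below s \<and> feq r z w"
      if "vpair w t \<in> elts y" "q \<in> below p" "q \<in> below t" for w t q
      using *[OF assms(2,1) that assms(5)] feq_sym by blast
  qed
qed

text \<open>Given a forced member of one name, pass to a condition that forces the equality and
  transport the membership there; \<open>feq_ext\<close> permits this strengthening.\<close>

lemma feq_dense:
  assumes "name x" "name y" "p \<in> elts Q" "\<And>q. q \<in> below p \<Longrightarrow> \<exists>r\<in>below q. feq r x y"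
  shows "feq p x y"
proof (rule feq_ext)
  fix q w assume *: "q \<in> below p" "name w"
  then obtain r where r: "r \<in> below q" "feq r x y" using assms by blast
  have rq: "r \<in> elts Q" "q \<in> elts Q" using * r by auto
  show "\<exists>r\<in>below q. fmem r w y" if "fmem q w x"
    using fmem_cong_right[OF fmem_mono[OF that r(1)] r(2)] * r assms rq by blast
  show "\<exists>r\<in>below q. fmem r w x" if "fmem q w y"
    using fmem_cong_right[OF fmem_mono[OF that r(1)] feq_sym[OF r(2)]] * r assms rq by blast
qed (use assms in auto)

subsection \<open>Names of pairs\<close>

text \<open>All conditions are attached to each component, as in \<open>check\<close>, since there
  need not be a weakest one.\<close>

definition upair :: "'v \<Rightarrow> 'v \<Rightarrow> 'v" where
  "upair x y = vset ((\<lambda>p. vpair x p) ` elts Q \<union> (\<lambda>p. vpair y p) ` elts Q)"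

definition opair :: "'v \<Rightarrow> 'v \<Rightarrow> 'v" where
  "opair x y = upair (upair x x) (upair x y)"

lemma elts_upair: "elts (upair x y) = {vpair z p | z p. z \<in> {x, y} \<and> p \<in> elts Q}"
proof -
  have "is_small (\<Union>z\<in>{x, y}. (\<lambda>p. vpair z p) ` elts Q)"
    by (intro is_small_Union is_small_image) auto
  then show ?thesis unfolding upair_def by (subst elts_vset) auto
qed

lemma name_upair: "name x \<Longrightarrow> name y \<Longrightarrow> name (upair x y)"
  by (rule is_name.intros) (auto simp: elts_upair)

lemma name_opair: "name x \<Longrightarrow> name y \<Longrightarrow> name (opair x y)"
  by (simp add: opair_def name_upair)

text \<open>With this choice of conditions both sides are the same name, not merely forced
  equal.\<close>

lemma upair_check: "upair (check Q x) (check Q y) = check Q (vset {x, y})"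
  by (rule extensionality) (auto simp: elts_upair elts_check)

lemma opair_check: "opair (check Q x) (check Q y) = check Q (vpair x y)"
  using upair_check[of x x] by (simp add: opair_def upair_check vpair_def)

lemma fmem_upair:
  "fmem p w (upair x y) \<longleftrightarrow> (\<forall>q\<in>below p. \<exists>r\<in>below q. feq r w x \<or> feq r w y)"
proof -
  have "(\<exists>z t. vpair z t \<in> elts (upair x y) \<and> r \<in> below t \<and> feq r w z) \<longleftrightarrow> feq r w x \<or> feq r w y"
    if "r \<in> below q" for r q
  proof -
    have "\<exists>t. t \<in> elts Q \<and> r \<in> below t" using that below_refl by blast
    then show ?thesis
      unfolding elts_upair by (simp del: elts_vpair) blast
  qed
  then show ?thesis unfolding forces_mem_def by (simp cong: bex_cong)
qed

lemma upair_left: "name x \<Longrightarrow> fmem p x (upair x y)"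
  unfolding fmem_upair using below_refl feq_refl by blast

lemma upair_right: "name y \<Longrightarrow> fmem p y (upair x y)"
  unfolding fmem_upair using below_refl feq_refl by blast

lemma upair_cong:
  assumes "name x" "name y" "name x'" "name y'" "p \<in> elts Q" "feq p x x'" "feq p y y'"
  shows "feq p (upair x y) (upair x' y')"
proof (rule feq_ext)
  have *: "\<exists>r\<in>below q. fmem r w (upair x' y')"
    if h: "name x" "name y" "name x'" "name y'" "feq p x x'" "feq p y y'"
      "q \<in> below p" "name w" "fmem q w (upair x y)" for x y x' y' q w
  proof
    have q: "q \<in> elts Q" using h by blast
    show "q \<in> below q" using q by simp
    show "fmem q w (upair x' y')"
      unfolding fmem_upair
    proof
      fix r assume r: "r \<in> below q"
      then obtain s where s: "s \<in> below r" "feq s w x \<or> feq s w y"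
        using h(9) unfolding fmem_upair by blast
      have "s \<in> elts Q" "s \<in> below p" using s r h(7) below_trans q assms(5) by blast+
      then have "feq s x x'" "feq s y y'" using feq_mono h(5,6) assms(5) by blast+
      then have "feq s w x' \<or> feq s w y'"
        using s(2) feq_trans h(1-4,8) \<open>s \<in> elts Q\<close> by blast
      then show "\<exists>s\<in>below r. feq s w x' \<or> feq s w y'" using s by blast
    qed
  qed
  show "\<exists>r\<in>below q. fmem r w (upair x' y')"
    if "q \<in> below p" "name w" "fmem q w (upair x y)" for q w
    using * assms that by blast
  show "\<exists>r\<in>below q. fmem r w (upair x y)"
    if "q \<in> below p" "name w" "fmem q w (upair x' y')" for q w
    using *[of x' y' x y q w] assms that feq_sym by blast
qed (use assms name_upair in auto)

lemma opair_cong: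
  assumes "name x" "name y" "name x'" "name y'" "p \<in> elts Q" "feq p x x'" "feq p y y'"
  shows "feq p (opair x y) (opair x' y')"
  unfolding opair_def using assms by (intro upair_cong name_upair)

lemma fmem_upairE:
  assumes "fmem p w (upair x y)" "p \<in> elts Q"
  obtains r where "r \<in> below p" "feq r w x \<or> feq r w y"
  using assms fmem_upair below_refl by blast

text \<open>The usual argument for Kuratowski pairs, carried out densely: \<open>{x}\<close> is
  forced to equal \<open>{x'}\<close> or \<open>{x', y'}\<close>, and either way \<open>x'\<close>
  becomes a member of \<open>{x}\<close>.\<close>

lemma opair_inject_left:
  assumes n: "name x" "name y" "name x'" "name y'" "p \<in> elts Q"
    and eq: "feq p (opair x y) (opair x' y')"
  shows "feq p x x'"
proof (rule feq_dense)
  fix q assume q: "q \<in> below p"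
  have nn: "name (upair x x)" "name (upair x y)" "name (upair x' x')" "name (upair x' y')"
    "name (opair x y)" "name (opair x' y')"
    using n by (auto intro: name_upair name_opair)
  have "q \<in> elts Q" using q by blast
  have "fmem q (upair x x) (opair x y)" unfolding opair_def using nn by (intro upair_left)
  then have "fmem q (upair x x) (opair x' y')"
    using fmem_cong_right feq_mono[OF eq q \<open>p \<in> elts Q\<close>] nn \<open>q \<in> elts Q\<close> by blast
  then obtain r where r: "r \<in> below q" "feq r (upair x x) (upair x' x') \<or> feq r (upair x x) (upair x' y')"
    unfolding opair_def using fmem_upairE nn \<open>q \<in> elts Q\<close> by metis
  have "r \<in> elts Q" using r by blast
  have "fmem r x' (upair x x)"
    using r(2) upair_left[of x' r x'] upair_left[of x' r y'] n nn \<open>r \<in> elts Q\<close> feq_sym fmem_cong_right by blast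
  then obtain s where "s \<in> below r" "feq s x' x"
    using fmem_upairE n \<open>r \<in> elts Q\<close> by metis
  then show "\<exists>r\<in>below q. feq r x x'" using r \<open>q \<in> elts Q\<close> below_trans feq_sym by blast
qed (use n in auto)

text \<open>Densely, \<open>y\<close> is \<open>x'\<close> or \<open>y'\<close>, and
  \<open>y'\<close> is \<open>x\<close> or \<open>y\<close>. With the first components equal, the
  remaining mixed case gives \<open>y = x' = x = y'\<close>.\<close>

lemma opair_inject_right:
  assumes n: "name x" "name y" "name x'" "name y'" "p \<in> elts Q"
    and eq: "feq p (opair x y) (opair x' y')"
  shows "feq p y y'"
proof (rule feq_dense)
  fix q assume q: "q \<in> below p"
  have nn: "name (upair x x)" "name (upair x y)" "name (upair x' x')" "name (upair x' y')"
    "name (opair x y)" "name (opair x' y')"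
    using n by (auto intro: name_upair name_opair)
  have qQ: "q \<in> elts Q" using q by blast
  have xx: "feq p x x'" using opair_inject_left assms by blast
  have key: "\<exists>s\<in>below r. feq s b a' \<or> feq s b b'"
    if h: "name a" "name b" "name a'" "name b'" "r \<in> elts Q" "feq r (opair a b) (opair a' b')" for r a b a' b'
  proof -
    have mm: "name (upair a a)" "name (upair a b)" "name (upair a' a')" "name (upair a' b')"
      "name (opair a b)" "name (opair a' b')"
      using h by (auto intro: name_upair name_opair)
    have "fmem r (upair a b) (opair a b)" unfolding opair_def using mm by (intro upair_right)
    then have "fmem r (upair a b) (opair a' b')"
      using fmem_cong_right h mm by blast
    then obtain s where s: "s \<in> below r" "feq s (upair a b) (upair a' a') \<or> feq s (upair a b) (upair a' b')"
      unfolding opair_def using fmem_upairE mm h by metis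
    have sQ: "s \<in> elts Q" using s by blast
    have "fmem s b (upair a' a') \<or> fmem s b (upair a' b')"
      using s(2) upair_right[of b s a] h mm sQ fmem_cong_right by blast
    then obtain t where "t \<in> below s" "feq t b a' \<or> feq t b b'"
      using fmem_upairE h sQ by metis
    then show ?thesis using s below_trans h by blast
  qed
  have eqq: "feq q (opair x y) (opair x' y')" using feq_mono eq q n by blast
  obtain r where r: "r \<in> below q" "feq r y x' \<or> feq r y y'"
    using key[OF n(1-4) qQ eqq] by blast
  have rQ: "r \<in> elts Q" using r by blast
  have eqr: "feq r (opair x' y') (opair x y)" using feq_mono eqq r qQ feq_sym by blast
  obtain s where s: "s \<in> below r" "feq s y' x \<or> feq s y' y"
    using key[OF n(3,4,1,2) rQ eqr] by blast
  have sQ: "s \<in> elts Q" using s by blast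
  have sp: "s \<in> below p" using s r q below_trans n qQ by blast
  have xs: "feq s x x'" using feq_mono xx sp n by blast
  have "feq s y x' \<or> feq s y y'" using r(2) feq_mono s rQ by blast
  then have "feq s y y'" using s(2) xs feq_trans feq_sym n sQ by meson
  then show "\<exists>r\<in>below q. feq r y y'" using s r qQ below_trans by blast
qed (use n in auto)

subsection \<open>Canonical names\<close>

lemma name_check [simp]: "name (check Q x)" by (rule is_name_check)

text \<open>Matching members of canonical names are again canonical, so induction along membership
  applies: no condition identifies distinct sets of the ground universe.\<close>

lemma feq_check_iff: "p \<in> elts Q \<Longrightarrow> feq p (check Q x) (check Q y) \<longleftrightarrow> x = y"
proof
  show "feq p (check Q x) (check Q y) \<Longrightarrow> p \<in> elts Q \<Longrightarrow> x = y"
  proof (induction x arbitrary: y p rule: wf_induct_rule[OF foundation])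
    case (1 x)
    have "elts x = elts y"
    proof (safe)
      fix z assume z: "z \<in> elts x"
      then have "vpair (check Q z) p \<in> elts (check Q x)" using 1(3) by (auto simp: elts_check)
      from feqD1[OF 1(2) this below_refl[OF 1(3)] below_refl[OF 1(3)]] obtain r w where "r \<in> elts Q" "w \<in> elts y" "feq r (check Q z) (check Q w)"
        by (auto simp: elts_check simp del: elts_vpair)
      then show "z \<in> elts y" using 1(1) z by blast
    next
      fix w assume w: "w \<in> elts y"
      then have "vpair (check Q w) p \<in> elts (check Q y)" using 1(3) by (auto simp: elts_check)
      from feqD2[OF 1(2) this below_refl[OF 1(3)] below_refl[OF 1(3)]] obtain r z where "r \<in> elts Q" "z \<in> elts x" "feq r (check Q z) (check Q w)"
        by (auto simp: elts_check simp del: elts_vpair)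
      then show "w \<in> elts x" using 1(1) by blast
    qed
    then show ?case by (rule extensionality)
  qed
qed (simp add: feq_refl)

text \<open>This is the source of decisions: below a stronger condition, a member of a canonical
  name becomes one particular set of the ground universe.\<close>

lemma fmem_checkE:
  assumes "fmem p x (check Q y)" "p \<in> elts Q"
  obtains r z where "r \<in> below p" "z \<in> elts y" "feq r x (check Q z)"
proof -
  obtain r w t where "r \<in> below p" "vpair w t \<in> elts (check Q y)" "feq r x w"
    using fmemE[OF assms] by blast
  then show thesis using that by (auto simp: elts_check simp del: elts_vpair)
qed

lemma fmem_check_iff:
  assumes "p \<in> elts Q"
  shows "fmem p (check Q x) (check Q y) \<longleftrightarrow> x \<in> elts y"
proof
  assume "fmem p (check Q x) (check Q y)"
  then show "x \<in> elts y" using fmem_checkE assms feq_check_iff below_Q by metis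
next
  assume "x \<in> elts y"
  then have "vpair (check Q x) p \<in> elts (check Q y)" using assms by (auto simp: elts_check)
  then show "fmem p (check Q x) (check Q y)" by (rule fmemI_elem[rotated]) (use assms in auto)
qed

subsection \<open>Forcing the abbreviated formulas\<close>

text \<open>These connectives are built from negations, which turn into density below the condition;
  later arguments use only this density form.\<close>

lemma force_abbrevs:
  "force (Imp \<phi> \<psi>) p e \<longleftrightarrow> (\<forall>q\<in>below p. force \<phi> q e \<longrightarrow> (\<exists>r\<in>below q. force \<psi> r e))"
  "force (Or \<phi> \<psi>) p e \<longleftrightarrow> (\<forall>q\<in>below p. \<exists>r\<in>below q. force \<phi> r e \<or> force \<psi> r e)"
  "force (Ex i \<phi>) p e \<longleftrightarrow> (\<forall>q\<in>below p. \<exists>x. name x \<and> (\<exists>r\<in>below q. force \<phi> r (e(i := x))))"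
  by (auto simp: Imp_def Or_def Ex_def)

lemma force_is_upair:
  assumes "p \<in> elts Q" "name (e u)" "name (e x)" "name (e y)"
  shows "force (is_upair u x y) p e \<longleftrightarrow> feq p (e u) (upair (e x) (e y))"
proof -
  note n = assms
  have eq: "force (is_upair u x y) p e \<longleftrightarrow> (\<forall>w. name w \<longrightarrow>
     (\<forall>q\<in>below p. fmem q w (e u) \<longrightarrow> (\<exists>r\<in>below q. fmem r w (upair (e x) (e y)))) \<and>
     (\<forall>q\<in>below p. fmem q w (upair (e x) (e y)) \<longrightarrow> (\<exists>r\<in>below q. fmem r w (e u))))"
    using n by (auto simp: is_upair_def Let_def Iff_def force_abbrevs fmem_upair)
  have nu: "name (upair (e x) (e y))" using n name_upair by blast
  show ?thesis
    unfolding eq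
  proof
    assume "feq p (e u) (upair (e x) (e y))"
    then show "\<forall>w. name w \<longrightarrow>
     (\<forall>q\<in>below p. fmem q w (e u) \<longrightarrow> (\<exists>r\<in>below q. fmem r w (upair (e x) (e y)))) \<and>
     (\<forall>q\<in>below p. fmem q w (upair (e x) (e y)) \<longrightarrow> (\<exists>r\<in>below q. fmem r w (e u)))"
      by (meson feq_mono feq_sym fmem_cong_right nu n below_refl below_Q)
  qed (use n nu in \<open>intro feq_ext, blast+\<close>)
qed

text \<open>Two existential quantifiers produce two nested layers of density, which
  \<open>feq_dense\<close> removes. Conversely \<open>upair (e x) (e x)\<close> and
  \<open>upair (e x) (e y)\<close> are witnesses at every condition below \<open>p\<close>.\<close>

lemma force_is_pair:
  assumes "p \<in> elts Q" "name (e u)" "name (e x)" "name (e y)"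
  shows "force (is_pair u x y) p e \<longleftrightarrow> feq p (e u) (opair (e x) (e y))"
proof -
  note n = assms
  have eq: "force (is_pair u x y) p e \<longleftrightarrow> (\<forall>q\<in>below p. \<exists>a. name a \<and> (\<exists>r\<in>below q.
      \<forall>q\<in>below r. \<exists>b. name b \<and> (\<exists>r\<in>below q.
        feq r a (upair (e x) (e x)) \<and> feq r b (upair (e x) (e y)) \<and> feq r (e u) (upair a b))))"
    using n below_Q
    by (simp add: is_pair_def Let_def force_abbrevs force_is_upair conj_assoc cong: conj_cong bex_cong ball_cong)
  have nn: "name (upair (e x) (e x))" "name (upair (e x) (e y))" "name (opair (e x) (e y))"
    using n name_upair name_opair by blast+
  show ?thesis
    unfolding eq
  proof
    assume L: "\<forall>q\<in>below p. \<exists>a. name a \<and> (\<exists>r\<in>below q.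
      \<forall>q\<in>below r. \<exists>b. name b \<and> (\<exists>r\<in>below q.
        feq r a (upair (e x) (e x)) \<and> feq r b (upair (e x) (e y)) \<and> feq r (e u) (upair a b)))"
    show "feq p (e u) (opair (e x) (e y))"
    proof (rule feq_dense)
      fix q assume q: "q \<in> below p"
      then obtain a r where a: "name a" "r \<in> below q" and r: "\<forall>q\<in>below r. \<exists>b. name b \<and> (\<exists>r\<in>below q.
        feq r a (upair (e x) (e x)) \<and> feq r b (upair (e x) (e y)) \<and> feq r (e u) (upair a b))"
        using L by blast
      have "r \<in> below r" using a by auto
      then obtain b s where b: "name b" "s \<in> below r" "feq s a (upair (e x) (e x))"
          "feq s b (upair (e x) (e y))" "feq s (e u) (upair a b)"
        using r by blast
      have sQ: "s \<in> elts Q" using b by blast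
      have "feq s (upair a b) (opair (e x) (e y))"
        unfolding opair_def using b a nn sQ by (intro upair_cong)
      then have "feq s (e u) (opair (e x) (e y))"
        using feq_trans[OF n(2) name_upair[OF a(1) b(1)] nn(3) sQ b(5)] by blast
      then show "\<exists>r\<in>below q. feq r (e u) (opair (e x) (e y))"
        using below_trans a b q by blast
    qed (use n nn in auto)
  next
    assume R: "feq p (e u) (opair (e x) (e y))"
    show "\<forall>q\<in>below p. \<exists>a. name a \<and> (\<exists>r\<in>below q.
      \<forall>q\<in>below r. \<exists>b. name b \<and> (\<exists>r\<in>below q.
        feq r a (upair (e x) (e x)) \<and> feq r b (upair (e x) (e y)) \<and> feq r (e u) (upair a b)))"
    proof
      fix q assume q: "q \<in> below p"
      have "\<exists>b. name b \<and> (\<exists>s\<in>below r. feq s (upair (e x) (e x)) (upair (e x) (e x)) \<and>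
          feq s b (upair (e x) (e y)) \<and> feq s (e u) (upair (upair (e x) (e x)) b))"
        if r: "r \<in> below q" for r
      proof -
        have "r \<in> elts Q" "r \<in> below p" using r q below_trans n by blast+
        then have "feq r (e u) (upair (upair (e x) (e x)) (upair (e x) (e y)))"
          using feq_mono[OF R] n unfolding opair_def by blast
        then show ?thesis using nn feq_refl below_refl \<open>r \<in> elts Q\<close> by blast
      qed
      then show "\<exists>a. name a \<and> (\<exists>r\<in>below q.
        \<forall>q\<in>below r. \<exists>b. name b \<and> (\<exists>r\<in>below q.
          feq r a (upair (e x) (e x)) \<and> feq r b (upair (e x) (e y)) \<and> feq r (e u) (upair a b)))"
        using nn q below_refl by blast
    qed
  qed
qed

lemma exists_pair_in_iff:
  assumes "p \<in> elts Q" "name x" "name y" "name f"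
  shows "(\<forall>q\<in>below p. \<exists>u. name u \<and> (\<exists>r\<in>below q. feq r u (opair x y) \<and> fmem r u f)) \<longleftrightarrow>
    fmem p (opair x y) f"
    (is "?L \<longleftrightarrow> ?R")
proof
  have n: "name (opair x y)" using assms name_opair by blast
  show "?L \<Longrightarrow> ?R"
    by (rule fmem_dense) (meson n assms below_Q fmem_cong_left)
  show "?R \<Longrightarrow> ?L"
    by (meson n assms below_Q below_refl feq_refl fmem_mono)
qed

lemma force_pair_in:
  assumes "p \<in> elts Q" "name (e x)" "name (e y)" "name (e f)"
  shows "force (pair_in x y f) p e \<longleftrightarrow> fmem p (opair (e x) (e y)) (e f)"
proof -
  have "force (pair_in x y f) p e \<longleftrightarrow>
     (\<forall>q\<in>below p. \<exists>u. name u \<and> (\<exists>r\<in>below q. feq r u (opair (e x) (e y)) \<and> fmem r u (e f)))"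
    using assms below_Q
    by (simp add: pair_in_def Let_def force_abbrevs force_is_pair cong: conj_cong bex_cong ball_cong)
  then show ?thesis using exists_pair_in_iff assms by blast
qed

lemma force_triple_in:
  assumes "p \<in> elts Q" "name (e x)" "name (e y)" "name (e z)" "name (e m)"
  shows "force (triple_in x y z m) p e \<longleftrightarrow> fmem p (opair (opair (e x) (e y)) (e z)) (e m)"
    (is "_ \<longleftrightarrow> ?R")
proof -
  have n: "name (opair (e x) (e y))" "name (opair (opair (e x) (e y)) (e z))"
    using assms name_opair by blast+
  have "force (triple_in x y z m) p e \<longleftrightarrow>
     (\<forall>q\<in>below p. \<exists>u. name u \<and> (\<exists>r\<in>below q. feq r u (opair (e x) (e y)) \<and> fmem r (opair u (e z)) (e m)))"
    using assms below_Q
    by (simp add: triple_in_def Let_def force_abbrevs force_is_pair force_pair_in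
        cong: conj_cong bex_cong ball_cong)
  also have "\<dots> \<longleftrightarrow> ?R"
  proof
    assume L: "\<forall>q\<in>below p. \<exists>u. name u \<and>
      (\<exists>r\<in>below q. feq r u (opair (e x) (e y)) \<and> fmem r (opair u (e z)) (e m))"
    show ?R
    proof (rule fmem_dense)
      fix q assume "q \<in> below p"
      then obtain u r where u: "name u" "r \<in> below q" "feq r u (opair (e x) (e y))"
          "fmem r (opair u (e z)) (e m)"
        using L by blast
      have "r \<in> elts Q" using u by blast
      then have "feq r (opair u (e z)) (opair (opair (e x) (e y)) (e z))"
        using u n assms feq_refl by (intro opair_cong) auto
      then show "\<exists>r\<in>below q. fmem r (opair (opair (e x) (e y)) (e z)) (e m)"
        using fmem_cong_left[OF u(4)] n u assms name_opair \<open>r \<in> elts Q\<close> by blast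
    qed
  next
    assume ?R
    then show "\<forall>q\<in>below p. \<exists>u. name u \<and>
      (\<exists>r\<in>below q. feq r u (opair (e x) (e y)) \<and> fmem r (opair u (e z)) (e m))"
      by (meson n assms below_Q below_refl feq_refl fmem_mono)
  qed
  finally show ?thesis .
qed

subsection \<open>Forcing the Hopf property\<close>

text \<open>A name \<open>F\<close> of a surjective endomorphism yields the stages
  \<open>graph r\<close>, the pairs of ground elements that \<open>r\<close> forces into
  \<open>F\<close>. They form an extension system in the ground universe and so have single-valued
  converses. Since members of \<open>F\<close> are densely decided to be canonical pairs,
  injectivity passes to \<open>F\<close>.\<close>

lemma force_hopfian_fm:
  fixes G :: "'v monoid"
  assumes small: "is_small (carrier G)" and G: "group G" and H: "persistently_hopfian G"
  shows "forced Q R hopfian_fm (\<lambda>i. check Q (group_assignment G i))"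
proof -
  interpret group G by (rule G)
  let ?C = "carrier G"
  define C where "C = check Q (vset ?C)"
  define M where "M = check Q (mult_graph G)"
  have C_elts: "elts (vset ?C) = ?C" by (rule elts_vset[OF small])
  have M_elts: "vpair (vpair x y) z \<in> elts (mult_graph G) \<longleftrightarrow> x \<in> ?C \<and> y \<in> ?C \<and> z = x \<otimes>\<^bsub>G\<^esub> y" for x y z
    by (auto simp: elts_mult_graph[OF small])
  define e where "e i = check Q (group_assignment G i)" for i
  have e: "e 0 = C" "i \<noteq> 0 \<Longrightarrow> e i = M" for i
    by (auto simp: e_def group_assignment_def C_def M_def)
  have nC [simp]: "name C" "name M" by (auto simp: C_def M_def)
  let ?ch = "check Q"
  have main: "\<exists>r\<in>below q. force (is_one_one 2) r (e(2 := F))"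
    if q: "q \<in> elts Q" and F: "name F"
      and fn: "force (is_function 2 0 0) q (e(2 := F))"
      and hm: "force (preserves_mult 2 1) q (e(2 := F))"
      and on: "force (is_onto 2 0 0) q (e(2 := F))" for q F
  proof -
    \<comment> \<open>The numbers 3 to 6 are the bound variables that \<open>is_function\<close>
      computes from the parameters 2, 0, 0.\<close>
    have fn1: "force (AllIn 3 2 (ExIn 4 0 (ExIn 5 0 (is_pair 3 4 5)))) q (e(2 := F))"
      and fn2: "force (AllIn 4 0 (Ex 5 (And (pair_in 4 5 2) (All 6 (Imp (pair_in 4 6 2) (Eq 6 5)))))) q (e(2 := F))"
      using fn by (simp_all add: is_function_def Let_def)
    \<comment> \<open>Here arbitrary names are exchanged for canonical ones, which is possible
      because the carrier is given by a canonical name.\<close>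
    have fn1: "\<exists>r'\<in>below r. \<exists>x\<in>?C. \<exists>y\<in>?C. feq r' a (?ch x) \<and> feq r' b (?ch y)"
      if r: "r \<in> below q" "name a" "name b" "fmem r (opair a b) F" for r a b
    proof -
      have nab: "name (opair a b)" using name_opair r by blast
      have rQ: "r \<in> elts Q" using r by blast
      have "\<forall>u. name u \<longrightarrow> (\<forall>r\<in>below q. fmem r u F \<longrightarrow> (\<exists>r\<in>below r. \<forall>q\<in>below r. \<exists>x. name x \<and> (\<exists>r\<in>below q.
          fmem r x C \<and> (\<forall>q\<in>below r. \<exists>y. name y \<and> (\<exists>r\<in>below q. fmem r y C \<and> feq r u (opair x y))))))"
        using fn1 F below_Q
        by (simp add: AllIn_def ExIn_def force_abbrevs force_is_pair e conj_assoc cong: conj_cong bex_cong ball_cong)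
      from this[rule_format, OF nab r(1,4)] obtain r1 where r1: "r1 \<in> below r"
        "\<forall>q\<in>below r1. \<exists>x. name x \<and> (\<exists>r\<in>below q.
          fmem r x C \<and> (\<forall>q\<in>below r. \<exists>y. name y \<and> (\<exists>r\<in>below q. fmem r y C \<and> feq r (opair a b) (opair x y))))"
        by blast
      have "r1 \<in> below r1" using r1 by auto
      then obtain x r2 where x: "name x" "r2 \<in> below r1" "fmem r2 x C" and
        r2: "\<forall>q\<in>below r2. \<exists>y. name y \<and> (\<exists>r\<in>below q. fmem r y C \<and> feq r (opair a b) (opair x y))"
        using r1(2) by blast
      have "r2 \<in> below r2" using x by auto
      then obtain y r3 where y: "name y" "r3 \<in> below r2" "fmem r3 y C" "feq r3 (opair a b) (opair x y)"
        using r2 by blast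
      have r3Q: "r3 \<in> elts Q" using y by blast
      obtain r4 g where g: "r4 \<in> below r3" "g \<in> ?C" "feq r4 x (?ch g)"
        using fmem_checkE[of r3 x "vset ?C"] fmem_mono[OF x(3) y(2)] x(2) r3Q below_Q
        unfolding C_def C_elts by blast
      obtain r5 h where h: "r5 \<in> below r4" "h \<in> ?C" "feq r5 y (?ch h)"
        using fmem_checkE[of r4 y "vset ?C"] fmem_mono[OF y(3) g(1)] r3Q g(1) below_Q
        unfolding C_def C_elts by blast
      have r5Q: "r5 \<in> elts Q" and r53: "r5 \<in> below r3" using h g r3Q below_trans by blast+
      have "feq r5 (opair a b) (opair x y)" using feq_mono[OF y(4) r53 r3Q] .
      then have "feq r5 a x" "feq r5 b y"
        using opair_inject_left opair_inject_right r(2,3) x(1) y(1) r5Q by blast+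
      moreover have "feq r5 x (?ch g)" using feq_mono g(3) h(1) g(1) by blast
      ultimately have "feq r5 a (?ch g)" "feq r5 b (?ch h)"
        using feq_trans r(2,3) x(1) y(1) h(3) r5Q name_check by blast+
      moreover have "r5 \<in> below r" using below_trans r53 y(2) x(2) r1(1) rQ below_Q by metis
      ultimately show ?thesis using g(2) h(2) by blast
    qed
    have fn2: "\<exists>r'\<in>below r. \<exists>y. name y \<and> fmem r' (opair (?ch x) y) F \<and>
        (\<forall>z. name z \<longrightarrow> (\<forall>q\<in>below r'. fmem q (opair (?ch x) z) F \<longrightarrow> (\<exists>r\<in>below q. feq r z y)))"
      if r: "r \<in> below q" and x: "x \<in> ?C" for r x
    proof -
      have "\<forall>u. name u \<longrightarrow> (\<forall>r\<in>below q. fmem r u C \<longrightarrow> (\<exists>r\<in>below r. \<forall>q\<in>below r. \<exists>y. name y \<and> (\<exists>r\<in>below q.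
          fmem r (opair u y) F \<and>
          (\<forall>z. name z \<longrightarrow> (\<forall>q\<in>below r. fmem q (opair u z) F \<longrightarrow> (\<exists>r\<in>below q. feq r z y))))))"
        using fn2 F below_Q
        by (simp add: AllIn_def force_abbrevs force_pair_in e conj_assoc cong: conj_cong bex_cong ball_cong imp_cong)
      moreover have "fmem r (?ch x) C" using r x fmem_check_iff C_elts unfolding C_def by blast
      ultimately obtain r1 where r1: "r1 \<in> below r" "\<forall>q\<in>below r1. \<exists>y. name y \<and> (\<exists>r\<in>below q.
          fmem r (opair (?ch x) y) F \<and>
          (\<forall>z. name z \<longrightarrow> (\<forall>q\<in>below r. fmem q (opair (?ch x) z) F \<longrightarrow> (\<exists>r\<in>below q. feq r z y))))"
        using r name_check by blast
      have "r1 \<in> below r1" using r1 by auto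
      then obtain y r2 where y: "name y" "r2 \<in> below r1" and r2: "fmem r2 (opair (?ch x) y) F \<and>
          (\<forall>z. name z \<longrightarrow> (\<forall>q\<in>below r2. fmem q (opair (?ch x) z) F \<longrightarrow> (\<exists>r\<in>below q. feq r z y)))"
        using r1(2) by blast
      have "r2 \<in> below r" using y r1(1) r below_trans below_Q by blast
      with y(1) r2 show ?thesis by blast
    qed
    have on: "\<exists>r'\<in>below r. \<exists>x. name x \<and> fmem r' (opair x (?ch y)) F"
      if r: "r \<in> below q" and y: "y \<in> ?C" for r y
    proof -
      have "\<forall>u. name u \<longrightarrow> (\<forall>r\<in>below q. fmem r u C \<longrightarrow> (\<exists>r\<in>below r. \<forall>q\<in>below r. \<exists>x. name x \<and> (\<exists>r\<in>below q.
          fmem r x C \<and> fmem r (opair x u) F)))"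
        using on F below_Q
        by (simp add: is_onto_def Let_def AllIn_def ExIn_def force_abbrevs force_pair_in e conj_assoc
            cong: conj_cong bex_cong ball_cong imp_cong)
      moreover have "fmem r (?ch y) C" using r y fmem_check_iff C_elts unfolding C_def by blast
      ultimately obtain r1 where r1: "r1 \<in> below r" "\<forall>q\<in>below r1. \<exists>x. name x \<and> (\<exists>r\<in>below q.
          fmem r x C \<and> fmem r (opair x (?ch y)) F)"
        using r name_check by blast
      have "r1 \<in> below r1" using r1 by auto
      then obtain x r2 where x: "name x" "r2 \<in> below r1" and r2: "fmem r2 (opair x (?ch y)) F"
        using r1(2) by blast
      have "r2 \<in> below r" using x r1(1) r below_trans below_Q by blast
      with x(1) r2 show ?thesis by blast
    qed
    have hm: "\<exists>r'\<in>below r. fmem r' (opair (opair x' y') z') M"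
      if r: "r \<in> below q" and n: "name x" "name y" "name z" "name x'" "name y'" "name z'"
        and h: "fmem r (opair (opair x y) z) M" "fmem r (opair x x') F" "fmem r (opair y y') F"
          "fmem r (opair z z') F" for r x y z x' y' z'
    proof -
      have "\<forall>x y z x' y' z'. name x \<longrightarrow> name y \<longrightarrow> name z \<longrightarrow> name x' \<longrightarrow> name y' \<longrightarrow> name z' \<longrightarrow>
         (\<forall>r\<in>below q. fmem r (opair (opair x y) z) M \<and> fmem r (opair x x') F \<and> fmem r (opair y y') F \<and>
           fmem r (opair z z') F \<longrightarrow> (\<exists>r\<in>below r. fmem r (opair (opair x' y') z') M))"
        using hm F below_Q
        by (simp add: preserves_mult_def Let_def force_abbrevs force_pair_in force_triple_in e conj_assoc
            cong: conj_cong bex_cong ball_cong imp_cong)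
      then show ?thesis using r n h by blast
    qed
    define graph where "graph r = {(g, h) \<in> ?C \<times> ?C. fmem r (opair (?ch g) (?ch h)) F}" for r
    have nop: "name (opair (?ch a) (?ch b))" for a b by (intro name_opair name_check)
    have graphI: "\<exists>s\<in>below r. (x, y) \<in> graph s"
      if r: "r \<in> below q" "name a" "name b" "fmem r (opair a b) F" "feq r a (?ch x)" "x \<in> ?C"
         "feq r b (?ch y)" "y \<in> ?C" for r a b x y
    proof -
      have rQ: "r \<in> elts Q" using r by blast
      have "feq r (opair a b) (opair (?ch x) (?ch y))" using r rQ by (intro opair_cong) auto
      then have "fmem r (opair (?ch x) (?ch y)) F"
        using fmem_cong_left[OF r(4)] name_opair r(2,3) nop F rQ by blast
      then show ?thesis using r rQ below_refl by (auto simp: graph_def)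
    qed
    have graph_mono: "graph r \<subseteq> graph s" if "s \<in> below r" "r \<in> below q" for r s
      unfolding graph_def using fmem_mono that below_Q by blast
    have graph_sv: "y = y'" if r: "r \<in> below q" and xy: "(x, y) \<in> graph r" "(x, y') \<in> graph r" for r x y y'
    proof -
      have x: "x \<in> ?C" using xy by (auto simp: graph_def)
      obtain r1 u where r1: "r1 \<in> below r" "name u" and
        u: "\<And>z q. name z \<Longrightarrow> q \<in> below r1 \<Longrightarrow> fmem q (opair (?ch x) z) F \<Longrightarrow> \<exists>r\<in>below q. feq r z u"
        using fn2[OF r x] by blast
      have rq: "r1 \<in> below q" using below_trans r1 r q by blast
      have xy1: "(x, y) \<in> graph r1" "(x, y') \<in> graph r1" using graph_mono[OF r1(1) r] xy by blast+
      have "r1 \<in> below r1" using r1 by auto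
      \<comment> \<open>Two strengthenings make both values equal to the same name \<open>u\<close>;
        canonical names forced equal denote the same element.\<close>
      then obtain r2 where r2: "r2 \<in> below r1" "feq r2 (?ch y) u"
        using u[of "?ch y" r1] xy1 by (auto simp: graph_def)
      have "(x, y') \<in> graph r2" using graph_mono[OF r2(1) rq] xy1 by blast
      then obtain r3 where r3: "r3 \<in> below r2" "feq r3 (?ch y') u"
        using u[of "?ch y'" r2] r2(1) by (auto simp: graph_def)
      have r3Q: "r3 \<in> elts Q" using r3 by blast
      have "feq r3 (?ch y) u" using feq_mono r2 r3 by blast
      then have "feq r3 (?ch y) (?ch y')"
        using feq_trans[of "?ch y" u "?ch y'" r3] feq_sym[OF r3(2)] r3Q r1(2) by simp
      then show ?thesis using feq_check_iff r3Q by blast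
    qed
    have "extension_system G (graph ` below q)"
    proof
      fix F1 assume "F1 \<in> graph ` below q"
      then obtain r where r: "r \<in> below q" "F1 = graph r" by blast
      have rQ: "r \<in> elts Q" using r by blast
      show "(x, y) \<in> F1 \<Longrightarrow> x \<in> ?C" "(x, y) \<in> F1 \<Longrightarrow> y \<in> ?C" for x y
        by (auto simp: r graph_def)
      show "(x, y) \<in> F1 \<Longrightarrow> (x, y') \<in> F1 \<Longrightarrow> y = y'" for x y y'
        using graph_sv[OF r(1)] unfolding r by blast
      show "\<exists>F'\<in>graph ` below q. F1 \<subseteq> F' \<and> (\<exists>y. (x, y) \<in> F')" if x: "x \<in> ?C" for x
      proof -
        obtain r1 y where r1: "r1 \<in> below r" "name y" "fmem r1 (opair (?ch x) y) F"
          using fn2[OF r(1) x] by blast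
        have "r1 \<in> below q" using below_trans r1 r q by blast
        then obtain r2 z where r2: "r2 \<in> below r1" "z \<in> ?C" "feq r2 y (?ch z)"
          using fn1[OF _ _ r1(2,3)] by auto
        have "r1 \<in> elts Q" "r2 \<in> below q" "r2 \<in> elts Q"
          using r2 r1 \<open>r1 \<in> below q\<close> below_trans q by blast+
        then obtain r3 where r3: "r3 \<in> below r2" "(x, z) \<in> graph r3"
          using graphI[of r2 "?ch x" y x z] fmem_mono[OF r1(3) r2(1)] r2 r1(2) x feq_refl by auto
        have "r3 \<in> below r" using r3 r2 r1 below_trans rQ below_Q by metis
        moreover have "r3 \<in> below q" using r3 \<open>r2 \<in> below q\<close> below_trans q by blast
        ultimately show ?thesis using graph_mono[of r3 r] r r3(2) by blast
      qed
      show "\<exists>F'\<in>graph ` below q. F1 \<subseteq> F' \<and> (\<exists>x. (x, y) \<in> F')" if y: "y \<in> ?C" for y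
      proof -
        obtain r1 x where r1: "r1 \<in> below r" "name x" "fmem r1 (opair x (?ch y)) F"
          using on[OF r(1) y] by blast
        have "r1 \<in> below q" using below_trans r1 r q by blast
        then obtain r2 z where r2: "r2 \<in> below r1" "z \<in> ?C" "feq r2 x (?ch z)"
          using fn1[OF _ r1(2) _ r1(3)] by auto
        have "r1 \<in> elts Q" "r2 \<in> below q" "r2 \<in> elts Q"
          using r2 r1 \<open>r1 \<in> below q\<close> below_trans q by blast+
        then obtain r3 where r3: "r3 \<in> below r2" "(z, y) \<in> graph r3"
          using graphI[of r2 x "?ch y" z y] fmem_mono[OF r1(3) r2(1)] r2 r1(2) y feq_refl by auto
        have "r3 \<in> below r" using r3 r2 r1 below_trans rQ below_Q by metis
        moreover have "r3 \<in> below q" using r3 \<open>r2 \<in> below q\<close> below_trans q by blast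
        ultimately show ?thesis using graph_mono[of r3 r] r r3(2) by blast
      qed
      show "(x \<otimes>\<^bsub>G\<^esub> x', y \<otimes>\<^bsub>G\<^esub> y') \<in> F1" if xy: "(x, y) \<in> F1" "(x', y') \<in> F1" for x y x' y'
      proof -
        have c: "x \<in> ?C" "x' \<in> ?C" "y \<in> ?C" "y' \<in> ?C" using xy by (auto simp: r graph_def)
        \<comment> \<open>The product pair must belong to the same stage \<open>r\<close>. It
          suffices to force it densely below \<open>r\<close>, where the value \<open>k\<close> at
          the product can be decided first.\<close>
        have "fmem r (opair (?ch (x \<otimes>\<^bsub>G\<^esub> x')) (?ch (y \<otimes>\<^bsub>G\<^esub> y'))) F"
        proof (rule fmem_dense)
          fix s assume s: "s \<in> below r"
          have sq: "s \<in> below q" using s r q below_trans by blast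
          obtain s1 z where s1: "s1 \<in> below s" "name z" "fmem s1 (opair (?ch (x \<otimes>\<^bsub>G\<^esub> x')) z) F"
            using fn2[OF sq, of "x \<otimes>\<^bsub>G\<^esub> x'"] c by blast
          have s1q: "s1 \<in> below q" using below_trans s1 sq q by blast
          obtain s2 k where s2: "s2 \<in> below s1" "k \<in> ?C" "feq s2 z (?ch k)"
            using fn1[OF s1q _ s1(2,3)] by auto
          have s2q: "s2 \<in> below q" using below_trans s2 s1q q by blast
          obtain s3 where s3: "s3 \<in> below s2" "(x \<otimes>\<^bsub>G\<^esub> x', k) \<in> graph s3"
            using graphI[OF s2q name_check s1(2) fmem_mono[OF s1(3) s2(1)] feq_refl[OF name_check] _ s2(3,2)]
              s1(1) s2(1) c by blast
          have s3q: "s3 \<in> below q" using below_trans s3 s2q q by blast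
          have s3s: "s3 \<in> below s" using s3 s2 s1 below_trans below_Q s by metis
          then have "s3 \<in> below r" using s rQ below_trans by blast
          then have "(x, y) \<in> graph s3" "(x', y') \<in> graph s3"
            using graph_mono[of s3 r] r xy by blast+
          \<comment> \<open>\<open>M\<close> is a canonical name, so every condition knows the
            multiplication table; \<open>hm\<close> then identifies \<open>k\<close>.\<close>
          moreover have "fmem s3 (opair (opair (?ch x) (?ch x')) (?ch (x \<otimes>\<^bsub>G\<^esub> x'))) M"
            using s3q c by (simp add: opair_check M_def fmem_check_iff[OF below_Q] M_elts del: elts_vpair)
          ultimately obtain s4 where s4: "s4 \<in> below s3" "fmem s4 (opair (opair (?ch y) (?ch y')) (?ch k)) M"
            using hm[OF s3q, of "?ch x" "?ch x'" "?ch (x \<otimes>\<^bsub>G\<^esub> x')" "?ch y" "?ch y'" "?ch k"] s3(2)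
            by (auto simp: graph_def)
          then have "k = y \<otimes>\<^bsub>G\<^esub> y'"
            by (simp add: opair_check M_def fmem_check_iff[OF below_Q] M_elts del: elts_vpair)
          then show "\<exists>s3\<in>below s. fmem s3 (opair (?ch (x \<otimes>\<^bsub>G\<^esub> x')) (?ch (y \<otimes>\<^bsub>G\<^esub> y'))) F"
            using s3(2) s3s by (auto simp: graph_def)
        qed
        then show ?thesis using c by (auto simp: r graph_def)
      qed
    qed
    then have inj: "x = x'" if "r \<in> below q" "(x, y) \<in> graph r" "(x', y) \<in> graph r" for r x x' y
      using H that unfolding persistently_hopfian_def single_valued_def by blast
    \<comment> \<open>For arbitrary names, both arguments and the common value are decided first.
      The two decided values agree since both equal \<open>c\<close>, and injectivity of the stage
      equates the decided arguments.\<close>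
    have "\<exists>s\<in>below r. feq s a b"
      if r: "r \<in> below q" and n: "name a" "name b" "name c" and h: "fmem r (opair a c) F" "fmem r (opair b c) F"
      for r a b c
    proof -
      have rQ: "r \<in> elts Q" using r by blast
      obtain r1 x z where r1: "r1 \<in> below r" "x \<in> ?C" "z \<in> ?C" "feq r1 a (?ch x)" "feq r1 c (?ch z)"
        using fn1[OF r n(1,3) h(1)] by blast
      have r1q: "r1 \<in> below q" and r1Q: "r1 \<in> elts Q" using below_trans r1 r q by blast+
      obtain r2 y w where r2: "r2 \<in> below r1" "y \<in> ?C" "w \<in> ?C" "feq r2 b (?ch y)" "feq r2 c (?ch w)"
        using fn1[OF r1q n(2,3) fmem_mono[OF h(2) r1(1) rQ]] by blast
      have r2q: "r2 \<in> below q" and r2Q: "r2 \<in> elts Q" and r2r: "r2 \<in> below r"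
        using below_trans r2 r1 r1q q rQ by blast+
      have eq2: "feq r2 a (?ch x)" "feq r2 c (?ch z)" using feq_mono r1 r2(1) r1Q by blast+
      have "feq r2 (?ch z) (?ch w)"
        using feq_trans[of "?ch z" c "?ch w" r2] feq_sym[OF eq2(2)] r2(5) n r2Q by simp
      then have zw: "z = w" using feq_check_iff r2Q by blast
      obtain r3 where r3: "r3 \<in> below r2" "(x, z) \<in> graph r3"
        using graphI[OF r2q n(1,3) fmem_mono[OF h(1) r2r rQ] eq2(1) r1(2) eq2(2) r1(3)] by blast
      have r3q: "r3 \<in> below q" and r3Q: "r3 \<in> elts Q" and r3r: "r3 \<in> below r"
        using below_trans r3 r2q q r2r rQ by blast+
      have eq3: "feq r3 a (?ch x)" "feq r3 b (?ch y)" "feq r3 c (?ch z)"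
        using feq_mono eq2 r2(4) r3(1) r2Q by blast+
      obtain r4 where r4: "r4 \<in> below r3" "(y, z) \<in> graph r4"
        using graphI[OF r3q n(2,3) fmem_mono[OF h(2) r3r rQ] eq3(2) r2(2) eq3(3) r1(3)] by blast
      have "r4 \<in> below q" using below_trans r4 r3q q by blast
      then have "x = y" using inj[of r4 x z y] r4 graph_mono[OF r4(1) r3q] r3 by blast
      then have "feq r3 a b"
        using feq_trans[of a "?ch x" b r3] eq3 feq_sym[OF eq3(2)] n r3Q by simp
      then show ?thesis using r3r by blast
    qed
    then have "force (is_one_one 2) q (e(2 := F))"
      using F q below_Q
      by (simp add: is_one_one_def Let_def force_abbrevs force_pair_in
            cong: conj_cong bex_cong ball_cong imp_cong)
    then show ?thesis using q below_refl by blast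
  qed
  have "force hopfian_fm p e" if "p \<in> elts Q" for p
    unfolding hopfian_fm_def forces.simps force_abbrevs using main that below_Q by blast
  then show ?thesis unfolding forced_def e_def by blast
qed

end

theorem persistently_hopfian_imp_absolutely_hopfian:
  fixes G :: "'v::zfc_universe monoid"
  assumes "is_small (carrier G)" "group G" "persistently_hopfian G"
  shows "absolutely_hopfian G"
  unfolding absolutely_hopfian_def
proof (intro conjI allI impI)
  show "hopfian G"
    using assms persistently_hopfian_imp_hopfian group.is_monoid by blast
  show "forced Q R hopfian_fm (\<lambda>i. check Q (group_assignment G i))" if "forcing_notion Q R" for Q R
    using forcing.force_hopfian_fm assms that by (simp add: forcing_def)
qed

section \<open>Cardinality\<close>

lemma infinite_times_eqpoll:
  assumes "infinite A"
  shows "A \<times> A \<approx> A"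
  using card_of_Times_same_infinite[OF assms] by (simp add: eqpoll_iff_card_of_ordIso)

context indexed_pairing
begin

text \<open>A vector is determined by the finite graph of its nonzero entries, and an infinite set
  has as many finite subsets as elements.\<close>

lemma vecs_lepoll:
  assumes W: "infinite W"
  shows "vecs \<lesssim> W"
proof -
  define graph where "graph v = {(t, v t) | t. v t \<noteq> 0}" for v :: "'i \<Rightarrow> rat"
  have "(UNIV :: rat set) \<lesssim> W"
  proof (rule lepoll_trans)
    show "(UNIV :: rat set) \<lesssim> (UNIV :: nat set)"
      unfolding lepoll_def using inj_to_nat by blast
    show "(UNIV :: nat set) \<lesssim> W" using W infinite_le_lepoll by blast
  qed
  then have "W \<times> (UNIV :: rat set) \<lesssim> W \<times> W" by (intro times_lepoll_mono) auto
  then have le: "W \<times> (UNIV :: rat set) \<lesssim> W"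
    using infinite_times_eqpoll[OF W] lepoll_trans2 by blast
  have inf: "infinite (W \<times> (UNIV :: rat set))" using W by (auto simp: finite_cartesian_product_iff)
  have "inj_on graph vecs"
  proof (rule inj_onI, rule ext)
    fix v w t assume "graph v = graph w"
    then have "\<And>r. (t, r) \<in> graph v \<longleftrightarrow> (t, r) \<in> graph w" by simp
    then show "v t = w t" unfolding graph_def by (simp) metis
  qed
  moreover have "graph ` vecs \<subseteq> Fpow (W \<times> UNIV)"
  proof -
    have "graph v = (\<lambda>t. (t, v t)) ` {t. v t \<noteq> 0}" for v by (auto simp: graph_def)
    then show ?thesis by (auto simp: Fpow_def vecs_def)
  qed
  ultimately have "vecs \<lesssim> Fpow (W \<times> (UNIV :: rat set))" unfolding lepoll_def by blast
  also have "\<dots> \<approx> W \<times> (UNIV :: rat set)" using eqpoll_Fpow[OF inf] .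
  also note le
  finally show ?thesis .
qed

lemma hopf_group_eqpoll:
  assumes W: "infinite W"
  shows "carrier hopf_group \<approx> W"
proof (rule lepoll_antisym)
  have "carrier hopf_group \<lesssim> vecs \<times> vecs"
    by (rule subset_imp_lepoll) (auto simp: hopf_group_def)
  also have "\<dots> \<lesssim> W \<times> W" by (intro times_lepoll_mono vecs_lepoll W)
  also have "\<dots> \<approx> W" using infinite_times_eqpoll[OF W] .
  finally show "carrier hopf_group \<lesssim> W" .
  \<comment> \<open>The basis vectors of the first summand give the lower bound.\<close>
  have "inl 1 (unit x) \<in> carrier hopf_group" if "x \<in> W" for x
    by (rule integral_in_carrier) (use unit_vecs[OF that] vecs_zero in \<open>auto simp: unit_def\<close>)
  moreover have "inj_on (\<lambda>x. inl 1 (unit x)) W"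
    by (rule inj_onI) (auto simp: inl_def unit_def fun_eq_iff split: if_splits)
  ultimately show "W \<lesssim> carrier hopf_group" unfolding lepoll_def by blast
qed

end

text \<open>The order is a well-order of the whole type, and the pairing is any bijection between
  \<open>W \<times> W\<close> and \<open>W\<close>; the two are chosen independently.\<close>

lemma infinite_indexed_pairing:
  fixes W :: "'i set"
  assumes "infinite W"
  shows "\<exists>lt code par lst. indexed_pairing W lt code par lst"
proof -
  obtain r :: "'i rel" where r: "well_order_on UNIV r" by (rule exE[OF well_order_on])
  define lt where "lt x y \<longleftrightarrow> (x, y) \<in> r - Id" for x y
  obtain f where f: "bij_betw f (W \<times> W) W"
    using infinite_times_eqpoll[OF assms] unfolding eqpoll_def by blast
  define g where "g = the_inv_into (W \<times> W) f"
  have inj: "inj_on f (W \<times> W)" and im: "f ` (W \<times> W) = W" using f by (auto simp: bij_betw_def)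
  have g1: "g (f p) = p" if "p \<in> W \<times> W" for p
    unfolding g_def using the_inv_into_f_f[OF inj that] .
  have g2: "f (g t) = t" "g t \<in> W \<times> W" if "t \<in> W" for t
  proof -
    have t: "t \<in> f ` (W \<times> W)" using im that by simp
    show "f (g t) = t" unfolding g_def by (rule f_the_inv_into_f[OF inj t])
    show "g t \<in> W \<times> W" unfolding g_def by (rule the_inv_into_into[OF inj t subset_refl])
  qed
  have ord: "wf (r - Id)" "trans r" "antisym r" "total_on UNIV r"
    using r unfolding well_order_on_def linear_order_on_def partial_order_on_def preorder_on_def by auto
  have "indexed_pairing W lt (\<lambda>s \<gamma>. f (s, \<gamma>)) (\<lambda>t. fst (g t)) (\<lambda>t. snd (g t))"
  proof
    have "{(x, y). lt x y} = r - Id" unfolding lt_def by blast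
    then show "wf {(x, y). lt x y}" using ord(1) by simp
    show "lt x y \<Longrightarrow> lt y z \<Longrightarrow> lt x z" for x y z
      using ord(2,3) unfolding lt_def trans_def antisym_def by blast
    show "lt x y \<or> x = y \<or> lt y x" for x y
      using ord(4) unfolding lt_def total_on_def by blast
    show "f (s, \<gamma>) \<in> W \<and> fst (g (f (s, \<gamma>))) = s \<and> snd (g (f (s, \<gamma>))) = \<gamma>" if "s \<in> W" "\<gamma> \<in> W" for s \<gamma>
      using g1[of "(s, \<gamma>)"] im that by auto
    show "fst (g t) \<in> W \<and> snd (g t) \<in> W \<and> f (fst (g t), snd (g t)) = t" if "t \<in> W" for t
      using g2[OF that] by (simp add: mem_Times_iff)
  qed
  then show ?thesis by blast
qed

section \<open>Transport of the group to a carrier inside the universe of sets\<close>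

lemma transport_comm_group:
  fixes A :: "'c set"
  assumes "comm_group G" and b: "bij_betw b (carrier G) A"
  obtains G' :: "'c monoid" where "carrier G' = A" "comm_group G'" "b \<in> iso G G'"
proof -
  interpret G: comm_group G by fact
  define c where "c = the_inv_into (carrier G) b"
  define G' where "G' = \<lparr>carrier = A, monoid.mult = (\<lambda>x y. b (c x \<otimes>\<^bsub>G\<^esub> c y)), one = b \<one>\<^bsub>G\<^esub>\<rparr>"
  have c: "\<And>x. x \<in> carrier G \<Longrightarrow> c (b x) = x"
    using b unfolding c_def bij_betw_def by (simp add: the_inv_into_f_f)
  have b_in: "\<And>x. x \<in> carrier G \<Longrightarrow> b x \<in> A" using b by (auto simp: bij_betw_def)
  have A: "\<exists>x'\<in>carrier G. x = b x'" if "x \<in> A" for x using b that by (auto simp: bij_betw_def)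
  have "comm_group G'"
  proof (rule comm_groupI)
    show "\<exists>y\<in>carrier G'. y \<otimes>\<^bsub>G'\<^esub> x = \<one>\<^bsub>G'\<^esub>" if x: "x \<in> carrier G'" for x
    proof -
      obtain x' where "x' \<in> carrier G" "x = b x'" using A x by (auto simp: G'_def)
      then show ?thesis
        by (intro bexI[of _ "b (inv\<^bsub>G\<^esub> x')"]) (simp_all add: G'_def c b_in)
    qed
    show "x \<otimes>\<^bsub>G'\<^esub> y \<otimes>\<^bsub>G'\<^esub> z = x \<otimes>\<^bsub>G'\<^esub> (y \<otimes>\<^bsub>G'\<^esub> z)"
      if "x \<in> carrier G'" "y \<in> carrier G'" "z \<in> carrier G'" for x y z
      using A[of x] A[of y] A[of z] that by (auto simp: G'_def c G.m_assoc)
    show "x \<otimes>\<^bsub>G'\<^esub> y = y \<otimes>\<^bsub>G'\<^esub> x" if "x \<in> carrier G'" "y \<in> carrier G'" for x y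
      using A[of x] A[of y] that by (auto simp: G'_def c G.m_comm)
    show "x \<otimes>\<^bsub>G'\<^esub> y \<in> carrier G'" if "x \<in> carrier G'" "y \<in> carrier G'" for x y
      using A[of x] A[of y] that by (auto simp: G'_def c b_in)
    show "\<one>\<^bsub>G'\<^esub> \<otimes>\<^bsub>G'\<^esub> x = x" if "x \<in> carrier G'" for x
      using A[of x] that by (auto simp: G'_def c)
  qed (simp add: G'_def b_in)
  moreover have "b \<in> iso G G'"
    using b by (auto simp: iso_def hom_def G'_def c b_in)
  ultimately show thesis using that[of G'] by (simp add: G'_def)
qed

lemma torsion_free_iso:
  assumes h: "h \<in> iso G G'" and G: "group G" "group G'" and tf: "torsion_free G"
  shows "torsion_free G'"
  unfolding torsion_free_def
proof (intro ballI allI impI)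
  interpret group_hom G G' h
    using h G by (simp add: group_hom_def group_hom_axioms_def iso_def)
  fix x and n :: nat
  assume x: "x \<in> carrier G'" and n: "n > 0 \<and> x [^]\<^bsub>G'\<^esub> n = \<one>\<^bsub>G'\<^esub>"
  obtain y where y: "y \<in> carrier G" "x = h y" using h x by (auto simp: iso_def bij_betw_def)
  then have "h (y [^]\<^bsub>G\<^esub> n) = h \<one>\<^bsub>G\<^esub>" using n by (simp add: hom_nat_pow)
  then have "y [^]\<^bsub>G\<^esub> n = \<one>\<^bsub>G\<^esub>"
    using h y(1) by (intro inj_onD[of h "carrier G"]) (auto simp: iso_def bij_betw_def)
  then show "x = \<one>\<^bsub>G'\<^esub>" using tf y n by (auto simp: torsion_free_def)
qed

theorem theorem1p3:
  fixes lam :: "'v::zfc_universe"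
  assumes "infinite_cardinal lam"
  shows "\<exists>G :: 'v monoid.
           is_small (carrier G) \<and> comm_group G \<and> torsion_free G \<and>
           carrier G \<approx> elts lam \<and> absolutely_hopfian G"
proof -
  have W: "infinite (elts lam)" using assms by (simp add: infinite_cardinal_def)
  then obtain lt code par lst where "indexed_pairing (elts lam) lt code par lst"
    using infinite_indexed_pairing by blast
  then interpret indexed_pairing "elts lam" lt code par lst .
  \<comment> \<open>The group built so far consists of pairs of functions; \<open>b\<close> moves it
    onto \<open>elts lam\<close>, which is small.\<close>
  obtain b where b: "bij_betw b (carrier hopf_group) (elts lam)"
    using hopf_group_eqpoll[OF W] unfolding eqpoll_def by blast
  obtain G' :: "'v monoid" where G': "carrier G' = elts lam" "comm_group G'" "b \<in> iso hopf_group G'"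
    using transport_comm_group[OF comm_group_hopf_group b] by blast
  have gr: "group hopf_group" "group G'"
    using comm_group_hopf_group G'(2) by (simp_all add: comm_group_def)
  have "persistently_hopfian G'"
    using persistently_hopfian_iso[OF persistently_hopfian_hopf_group, of b G'] G'(3) gadd_carrier
    by (auto simp: iso_def)
  then have "absolutely_hopfian G'"
    using persistently_hopfian_imp_absolutely_hopfian[OF _ gr(2)] G'(1) by simp
  moreover have "torsion_free G'"
    using torsion_free_iso[OF G'(3) gr torsion_free_hopf_group] .
  ultimately show ?thesis using G'(1,2) by (intro exI[of _ G']) simp
qed

end
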